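(* Let $K=\{x=(x_k)_{k\ge1}\in\ell^2:\ \|x\|\le 0.042\}$ and let $Gx=-BQ(x+Bw)$, where $B$, $Q$, $w$ are as defined in the context. Then $G$ maps $K$ into itself, and $$\|G(x)-G(y)\|\le 0.73\,\|x-y\|\qquad\text{for all } x,y\in K.$$
   Context: $\ell^2$ is the space of real square-summable sequences indexed by the positive integers, with norm $\|\cdot\|$. The sequence $w=(w_k)_{k\ge1}$ is $w_k=\frac{1}{\pi}\int_{-1/2}^{1/2}\frac{\cos (\pi x)}{(x-k)^2}\,dx$. The linear operator $A$ on $\ell^2$ is defined by $(Ax)_k=\sum_{n=1}^\infty a_{k,n}x_n$ for $k\ge1$, where $a_{k,n}=\frac{1}{n+k+\frac12}+\frac{1}{n-k+\frac12}$. It is bounded and invertible on $\ell^2$, and $B=A^{-1}$ denotes its inverse; explicitly, $(By)_n=\sum_{k=1}^\infty b_{n,k}y_k$ with $b_{n,k}=\frac{1-(2n+1)^{-2}}{\pi^2(1-(2k)^{-2})}\,a_{k,n}$. The nonlinear map $Q$ is defined by $$(Q\delta)_k=\sum_{n=1}^{\infty} \int_0^{\delta_n} \Big(\frac{\cos (\pi y)}{n+\frac{1}{2}-y+k}-\frac{1}{n+\frac12+k}+\frac{\cos (\pi y)}{n+\frac{1}{2}-y-k}-\frac{1}{n+\frac12-k}\Big)dy,\qquad k\ge1.$$ *)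

theory Defs
  imports "HOL-Analysis.Analysis"
begin

text \<open>
  Sequences indexed by the positive integers are functions on \<^typ>\<open>nat\<close> that vanish at index 0,
  so that equality of sequences is equality of functions. Accordingly, series over the positive
  integers are series over \<^typ>\<open>nat\<close> with the index shifted by \<^const>\<open>Suc\<close>.
\<close>

definition l2 :: "(nat \<Rightarrow> real) set" where
  "l2 = {x. x 0 = 0 \<and> summable (\<lambda>k. (x k)\<^sup>2)}"

definition l2_norm :: "(nat \<Rightarrow> real) \<Rightarrow> real" where
  "l2_norm x = sqrt (\<Sum>k. (x k)\<^sup>2)"

definition w_seq :: "nat \<Rightarrow> real" where
  "w_seq k = (if k = 0 then 0
     else 1 / pi * (LBINT x:{-1/2..1/2}. cos (pi * x) / (x - real k)\<^sup>2))"

definition a_coeff :: "nat \<Rightarrow> nat \<Rightarrow> real" where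
  "a_coeff k n = 1 / (real n + real k + 1/2) + 1 / (real n - real k + 1/2)"

definition A_op :: "(nat \<Rightarrow> real) \<Rightarrow> nat \<Rightarrow> real" where
  "A_op x k = (if k = 0 then 0 else \<Sum>m. a_coeff k (Suc m) * x (Suc m))"

definition B_op :: "(nat \<Rightarrow> real) \<Rightarrow> nat \<Rightarrow> real" where
  "B_op = the_inv_into l2 A_op"

text \<open>
  The integral from 0 to \<open>\<delta> n\<close> is oriented: for negative \<open>\<delta> n\<close> it is minus the integral
  over \<open>{\<delta> n..0}\<close>.
\<close>

definition Q_int :: "nat \<Rightarrow> nat \<Rightarrow> real \<Rightarrow> real" where
  "Q_int k n d = (LBINT y=ereal 0..ereal d.
     cos (pi * y) / (real n + 1/2 - y + real k) - 1 / (real n + 1/2 + real k)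
     + cos (pi * y) / (real n + 1/2 - y - real k) - 1 / (real n + 1/2 - real k))"

definition Q_map :: "(nat \<Rightarrow> real) \<Rightarrow> nat \<Rightarrow> real" where
  "Q_map \<delta> k = (if k = 0 then 0 else \<Sum>m. Q_int k (Suc m) (\<delta> (Suc m)))"

definition G_map :: "(nat \<Rightarrow> real) \<Rightarrow> nat \<Rightarrow> real" where
  "G_map x = (\<lambda>n. - B_op (Q_map (\<lambda>k. x k + B_op w_seq k)) n)"

definition K_ball :: "(nat \<Rightarrow> real) set" where
  "K_ball = {x \<in> l2. l2_norm x \<le> 0.042}"

end

(*
  The matrix A is close to pi times an isometry: partial fractions and telescoping give
  A^T A = pi^2 I - 2 u u^T and A A^T = pi^2 I - v v^T with explicit vectors u, v such that
  |u|^2 = pi^2/2 - 4 and |v|^2 = pi^2 - 8.  The first identity yields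
  sqrt 8 |x| <= |A x| <= pi |x|; the second gives an explicit preimage of every y, so that
  |B| <= 1 / sqrt 8.

  Subtracting from the integrand of Q its part proportional to a_{k,n} splits Q into A applied
  entrywise to h(d) = sin(pi d)/pi - d, which is cubically small, and a remainder dominated by
  the positive matrix 1/(n+1/2+k)^2 + 1/(n+1/2-k)^2, whose norm is at most pi^2 by Schur's test.
  On the ball of radius rho these two parts have Lipschitz constants pi * pi^2 rho^2 / 2 and
  pi^2 rho / (1 - 2 rho).  Symmetrising the integral for w_k bounds it by 0.2392 / k^2, whence
  |B w| <= 0.0888 and rho = 0.042 + 0.0888 = 0.1308 is small enough.
*)

theory Submission
  imports Defs "HOL-Real_Asymp.Real_Asymp"
begin

text \<open>For fixed k the entries a_{k,n} decay only like 2/n, so the rows of A are not absolutely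
  summable and no estimate by absolute values bounds A; its norm has to come from cancellation, that
  is, from exact Gram matrices. The same obstacle forces the splitting of Q: the terms carrying
  a_{k,n} must stay together as A applied to a sequence, and only the rest, which decays like 1/M^2
  in M = n + 1/2 +- k, may be estimated in absolute value. Since |M| >= 1/2, the poles y = M stay
  off the range of integration as long as \<rho> < 1/2; for this the l2 norm also serves as a bound
  on every single entry.

  The two claims need different estimates. From Q 0 = 0 the Lipschitz constant alone would give only
  |G x| <= 0.73 * 0.1308, about 0.095, which misses 0.042. Integrating the derivative bounds from 0,
  instead of taking their maximum, gains roughly a factor 2 in the remainder and a factor 3 in h,
  and that is enough.

  B is given as an inverse, so every statement about it waits for the bijectivity of A and is then
  read off from A.\<close>

section \<open>Square-summable sequences: norm and inner product\<close>

abbreviation sqs :: "(nat \<Rightarrow> real) \<Rightarrow> bool" where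
  "sqs x \<equiv> summable (\<lambda>k. (x k)\<^sup>2)"

definition ip :: "(nat \<Rightarrow> real) \<Rightarrow> (nat \<Rightarrow> real) \<Rightarrow> real" where
  "ip x y = (\<Sum>k. x k * y k)"

lemma L2_set_le_l2_norm: "sqs x \<Longrightarrow> finite F \<Longrightarrow> L2_set x F \<le> l2_norm x"
  unfolding L2_set_def l2_norm_def by (intro real_sqrt_le_mono sum_le_suminf) auto

lemma l2_norm_nonneg: "sqs x \<Longrightarrow> 0 \<le> l2_norm x"
  unfolding l2_norm_def by (simp add: suminf_nonneg)

lemma l2_norm_sq: "sqs x \<Longrightarrow> (l2_norm x)\<^sup>2 = (\<Sum>k. (x k)\<^sup>2)"
  unfolding l2_norm_def by (simp add: suminf_nonneg)

lemma sqs_bound: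
  assumes "\<And>K. (\<Sum>k<K. (x k)\<^sup>2) \<le> C\<^sup>2" "0 \<le> C"
  shows "sqs x" "l2_norm x \<le> C"
proof -
  show s: "sqs x"
    by (rule bounded_imp_summable[where B = "C\<^sup>2"])
       (use assms(1) in \<open>auto simp del: sum.lessThan_Suc simp flip: lessThan_Suc_atMost\<close>)
  have "(\<Sum>k. (x k)\<^sup>2) \<le> C\<^sup>2"
    by (rule suminf_le_const[OF s assms(1)])
  then show "l2_norm x \<le> C"
    unfolding l2_norm_def using assms(2) by (simp add: real_le_lsqrt)
qed

lemma
  assumes "sqs x" "sqs y" "\<And>k. \<bar>z k\<bar> \<le> \<bar>x k\<bar> + \<bar>y k\<bar>"
  shows sqs_dominated: "sqs z"
    and l2_norm_dominated: "l2_norm z \<le> l2_norm x + l2_norm y"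
proof -
  have "(\<Sum>k<K. (z k)\<^sup>2) \<le> (l2_norm x + l2_norm y)\<^sup>2" for K
  proof -
    have "L2_set z {..<K} \<le> L2_set (\<lambda>k. \<bar>x k\<bar> + \<bar>y k\<bar>) {..<K}"
      unfolding L2_set_def using assms(3)
      by (intro real_sqrt_le_mono sum_mono) (simp flip: abs_le_square_iff)
    also have "\<dots> \<le> L2_set x {..<K} + L2_set y {..<K}"
      using L2_set_triangle_ineq[of "\<lambda>k. \<bar>x k\<bar>" "\<lambda>k. \<bar>y k\<bar>" "{..<K}"] by (simp add: L2_set_def)
    also have "\<dots> \<le> l2_norm x + l2_norm y"
      by (intro add_mono L2_set_le_l2_norm assms) auto
    finally show ?thesis
      unfolding L2_set_def by (rule sqrt_le_D)
  qed
  moreover have "0 \<le> l2_norm x + l2_norm y" by (simp add: assms l2_norm_nonneg)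
  ultimately show "sqs z" "l2_norm z \<le> l2_norm x + l2_norm y" using sqs_bound by blast+
qed

lemma
  assumes "sqs x" "\<And>k. \<bar>z k\<bar> \<le> c * \<bar>x k\<bar>" "0 \<le> c"
  shows sqs_dominated_scale: "sqs z"
    and l2_norm_dominated_scale: "l2_norm z \<le> c * l2_norm x"
proof -
  have "(\<Sum>k<K. (z k)\<^sup>2) \<le> (c * l2_norm x)\<^sup>2" for K
  proof -
    have "(\<Sum>k<K. (z k)\<^sup>2) \<le> (\<Sum>k<K. c\<^sup>2 * (x k)\<^sup>2)"
      by (intro sum_mono) (metis abs_ge_zero abs_of_nonneg assms(2) power2_abs power_mono power_mult_distrib)
    also have "\<dots> = c\<^sup>2 * (\<Sum>k<K. (x k)\<^sup>2)" by (simp add: sum_distrib_left)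
    also have "\<dots> \<le> c\<^sup>2 * (\<Sum>k. (x k)\<^sup>2)"
      by (intro mult_left_mono sum_le_suminf assms) auto
    finally show ?thesis by (simp add: l2_norm_sq[OF assms(1)] power_mult_distrib)
  qed
  moreover have "0 \<le> c * l2_norm x" by (simp add: assms l2_norm_nonneg)
  ultimately show "sqs z" "l2_norm z \<le> c * l2_norm x" using sqs_bound by blast+
qed

lemma sqs_add: "sqs x \<Longrightarrow> sqs y \<Longrightarrow> sqs (\<lambda>k. x k + y k)"
  by (rule sqs_dominated[of x y]) (auto intro: abs_triangle_ineq)

lemma sqs_diff: "sqs x \<Longrightarrow> sqs y \<Longrightarrow> sqs (\<lambda>k. x k - y k)"
  by (rule sqs_dominated[of x y]) (auto intro: abs_triangle_ineq4)

lemma sqs_cmult: "sqs x \<Longrightarrow> sqs (\<lambda>k. c * x k)"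
  by (rule sqs_dominated_scale[of x _ "\<bar>c\<bar>"]) (auto simp: abs_mult)

lemma l2_norm_add: "sqs x \<Longrightarrow> sqs y \<Longrightarrow> l2_norm (\<lambda>k. x k + y k) \<le> l2_norm x + l2_norm y"
  by (rule l2_norm_dominated) (auto intro: abs_triangle_ineq)

lemma abs_le_l2_norm: "sqs x \<Longrightarrow> \<bar>x k\<bar> \<le> l2_norm x"
  using L2_set_le_l2_norm[of x "{k}"] by simp

lemma summable_prod: "summable (\<lambda>k. \<bar>x k * y k\<bar>)" if "sqs x" "sqs y"
proof (rule summable_comparison_test')
  show "summable (\<lambda>k. (x k)\<^sup>2 + (y k)\<^sup>2)" using that by (rule summable_add)
  show "norm \<bar>x k * y k\<bar> \<le> (x k)\<^sup>2 + (y k)\<^sup>2" if "k \<ge> 0" for k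
    using sum_squares_bound[of "\<bar>x k\<bar>" "\<bar>y k\<bar>"] mult_nonneg_nonneg[of "\<bar>x k\<bar>" "\<bar>y k\<bar>"]
    unfolding real_norm_def abs_idempotent abs_mult power2_abs mult.assoc by linarith
qed

lemma ip_sums: "sqs x \<Longrightarrow> sqs y \<Longrightarrow> (\<lambda>k. x k * y k) sums ip x y"
  unfolding ip_def by (rule summable_sums[OF summable_rabs_cancel[OF summable_prod]])

lemma ip_Cauchy_Schwarz:
  assumes "sqs x" "sqs y" shows "\<bar>ip x y\<bar> \<le> l2_norm x * l2_norm y"
proof -
  have "\<bar>ip x y\<bar> \<le> (\<Sum>k. \<bar>x k * y k\<bar>)"
    unfolding ip_def by (rule summable_rabs[OF summable_prod[OF assms]])
  also have "\<dots> \<le> l2_norm x * l2_norm y"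
  proof (rule suminf_le_const[OF summable_prod[OF assms]])
    fix K
    have "(\<Sum>k<K. \<bar>x k * y k\<bar>) \<le> L2_set x {..<K} * L2_set y {..<K}"
      using L2_set_mult_ineq[of x y "{..<K}"] by (simp add: abs_mult)
    also have "\<dots> \<le> l2_norm x * l2_norm y"
      by (intro mult_mono L2_set_le_l2_norm assms L2_set_nonneg l2_norm_nonneg) auto
    finally show "(\<Sum>k<K. \<bar>x k * y k\<bar>) \<le> l2_norm x * l2_norm y" .
  qed
  finally show ?thesis .
qed

lemma ip_commute: "ip x y = ip y x"
  by (simp add: ip_def mult.commute)

lemma ip_self: "sqs x \<Longrightarrow> ip x x = (l2_norm x)\<^sup>2"
  by (simp add: ip_def l2_norm_sq flip: power2_eq_square)

lemma ip_add_right: "sqs x \<Longrightarrow> sqs y \<Longrightarrow> sqs z \<Longrightarrow> ip x (\<lambda>k. y k + z k) = ip x y + ip x z"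
  using sums_add[OF ip_sums[of x y] ip_sums[of x z]]
  unfolding ip_def by (simp add: distrib_left sums_iff)

lemma ip_cmult_right: "sqs x \<Longrightarrow> sqs y \<Longrightarrow> ip x (\<lambda>k. c * y k) = c * ip x y"
  using sums_mult[OF ip_sums[of x y], of c]
  unfolding ip_def by (simp add: mult.left_commute sums_iff)

text \<open>Lets the adjoint relation \<open>ip_mv\<close> pass from truncated sequences to full
  ones.\<close>

lemma l2_norm_tail:
  assumes "sqs x"
  shows "(\<lambda>N. l2_norm (\<lambda>k. if k < N then 0 else x k)) \<longlonglongrightarrow> 0"
proof -
  have "(\<Sum>k. (if k < N then 0 else x k)\<^sup>2) = (\<Sum>k. (x k)\<^sup>2) - (\<Sum>k<N. (x k)\<^sup>2)" for N
  proof -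
    have "(\<lambda>k. if k \<in> {..<N} then (x k)\<^sup>2 else 0) sums (\<Sum>k<N. (x k)\<^sup>2)"
      by (rule sums_If_finite_set) simp
    from sums_diff[OF summable_sums[OF assms] this]
    have "(\<lambda>k. (x k)\<^sup>2 - (if k \<in> {..<N} then (x k)\<^sup>2 else 0)) sums
      ((\<Sum>k. (x k)\<^sup>2) - (\<Sum>k<N. (x k)\<^sup>2))" .
    moreover have "(\<lambda>k. (x k)\<^sup>2 - (if k \<in> {..<N} then (x k)\<^sup>2 else 0)) = (\<lambda>k. (if k < N then 0 else x k)\<^sup>2)"
      by auto
    ultimately show ?thesis by (simp add: sums_iff)
  qed
  moreover have "(\<lambda>N. (\<Sum>k. (x k)\<^sup>2) - (\<Sum>k<N. (x k)\<^sup>2)) \<longlonglongrightarrow> 0"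
    using tendsto_diff[OF tendsto_const summable_LIMSEQ[OF assms], of "\<Sum>k. (x k)\<^sup>2"] by simp
  ultimately show ?thesis
    unfolding l2_norm_def using tendsto_real_sqrt by fastforce
qed

section \<open>Infinite matrices as bounded operators\<close>

definition mv :: "(nat \<Rightarrow> nat \<Rightarrow> real) \<Rightarrow> (nat \<Rightarrow> real) \<Rightarrow> nat \<Rightarrow> real" where
  "mv M x k = (\<Sum>n. M k n * x n)"

text \<open>A bound on all finite sections, uniform in their size, raises no question of
  convergence; square-summable rows and columns and a bounded operator are consequences.\<close>

definition bounded_matrix :: "(nat \<Rightarrow> nat \<Rightarrow> real) \<Rightarrow> real \<Rightarrow> bool" where
  "bounded_matrix M C \<longleftrightarrow> 0 \<le> C \<and>
     (\<forall>K N x. (\<Sum>k<K. (\<Sum>n<N. M k n * x n)\<^sup>2) \<le> C\<^sup>2 * (\<Sum>n<N. (x n)\<^sup>2))"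

lemma bounded_matrixD:
  "bounded_matrix M C \<Longrightarrow> (\<Sum>k<K. (\<Sum>n<N. M k n * x n)\<^sup>2) \<le> C\<^sup>2 * (\<Sum>n<N. (x n)\<^sup>2)"
  by (simp add: bounded_matrix_def)

lemma bounded_matrix_nonneg: "bounded_matrix M C \<Longrightarrow> 0 \<le> C"
  by (simp add: bounded_matrix_def)

abbreviation (input) tr :: "(nat \<Rightarrow> nat \<Rightarrow> real) \<Rightarrow> nat \<Rightarrow> nat \<Rightarrow> real" where
  "tr M \<equiv> \<lambda>k n. M n k"

text \<open>Duality on finite sections: for z = M^T y, |z|^2 = <y, M z> <= |y| C |z|, and one factor
  |z| cancels.\<close>

lemma bounded_matrix_tr:
  assumes "bounded_matrix M C" shows "bounded_matrix (tr M) C"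
proof -
  have C: "0 \<le> C" by (rule bounded_matrix_nonneg[OF assms])
  have "(\<Sum>n<N. (\<Sum>k<K. M k n * y k)\<^sup>2) \<le> C\<^sup>2 * (\<Sum>k<K. (y k)\<^sup>2)" for N K y
  proof -
    define z where "z n = (\<Sum>k<K. M k n * y k)" for n
    let ?Z = "L2_set z {..<N}" and ?Y = "L2_set y {..<K}"
    have "?Z\<^sup>2 = (\<Sum>n<N. z n * z n)"
      by (simp add: L2_set_def sum_nonneg power2_eq_square)
    also have "\<dots> = (\<Sum>n<N. (\<Sum>k<K. M k n * y k) * z n)"
      by (simp only: z_def)
    also have "\<dots> = (\<Sum>k<K. y k * (\<Sum>n<N. M k n * z n))"
      by (simp only: sum_distrib_left sum_distrib_right, subst sum.swap, simp only: mult_ac)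
    also have "\<dots> \<le> (\<Sum>k<K. \<bar>y k\<bar> * \<bar>\<Sum>n<N. M k n * z n\<bar>)"
      by (intro sum_mono) (metis abs_ge_self abs_mult)
    also have "\<dots> \<le> ?Y * L2_set (\<lambda>k. \<Sum>n<N. M k n * z n) {..<K}"
      by (rule L2_set_mult_ineq)
    also have "\<dots> \<le> ?Y * (C * ?Z)"
    proof (intro mult_left_mono L2_set_nonneg)
      have "(\<Sum>k<K. (\<Sum>n<N. M k n * z n)\<^sup>2) \<le> C\<^sup>2 * (\<Sum>n<N. (z n)\<^sup>2)"
        by (rule bounded_matrixD[OF assms])
      then have "sqrt (\<Sum>k<K. (\<Sum>n<N. M k n * z n)\<^sup>2) \<le> sqrt (C\<^sup>2 * (\<Sum>n<N. (z n)\<^sup>2))" by simp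
      then show "L2_set (\<lambda>k. \<Sum>n<N. M k n * z n) {..<K} \<le> C * ?Z"
        using C by (simp add: L2_set_def real_sqrt_mult)
    qed
    finally have "?Z * ?Z \<le> (C * ?Y) * ?Z" by (metis mult.commute mult.left_commute power2_eq_square)
    then have "?Z \<le> C * ?Y"
      using C mult_right_le_imp_le[of ?Z ?Z "C * ?Y"] L2_set_nonneg[of z "{..<N}"] L2_set_nonneg[of y "{..<K}"]
      by (cases "?Z = 0") simp_all
    then have "?Z\<^sup>2 \<le> (C * ?Y)\<^sup>2" by (intro power_mono) auto
    then show ?thesis
      unfolding z_def by (simp add: L2_set_def power_mult_distrib sum_nonneg)
  qed
  then show ?thesis using C by (auto simp: bounded_matrix_def)
qed

lemma bounded_matrix_column:
  assumes "bounded_matrix M C" shows "sqs (\<lambda>k. M k n)"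
proof (rule sqs_bound(1))
  show "0 \<le> C" using assms by (simp add: bounded_matrix_def)
  fix K
  have e: "(\<Sum>i<Suc n. M k i * (if i = n then 1 else 0)) = M k n" for k
    by (subst sum.mono_neutral_right[of _ "{n}"]) auto
  have "(\<Sum>i<Suc n. (if i = n then 1 else 0 :: real)\<^sup>2) = 1"
    by (subst sum.mono_neutral_right[of _ "{n}"]) auto
  moreover have "(\<Sum>k<K. (\<Sum>i<Suc n. M k i * (if i = n then 1 else 0))\<^sup>2)
      \<le> C\<^sup>2 * (\<Sum>i<Suc n. (if i = n then 1 else 0)\<^sup>2)"
    by (rule bounded_matrixD[OF assms])
  ultimately show "(\<Sum>k<K. (M k n)\<^sup>2) \<le> C\<^sup>2" unfolding e by simp
qed

lemma bounded_matrix_row: "bounded_matrix M C \<Longrightarrow> sqs (M k)"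
  using bounded_matrix_column[OF bounded_matrix_tr[of M C], of k] by simp

lemma mv_sums: "bounded_matrix M C \<Longrightarrow> sqs x \<Longrightarrow> (\<lambda>n. M k n * x n) sums mv M x k"
  using ip_sums[OF bounded_matrix_row] by (simp add: mv_def ip_def)

lemma mv_ip: "mv M x k = ip (M k) x"
  by (simp add: mv_def ip_def)

text \<open>K is held fixed while N tends to infinity, so only finitely many entries pass to the
  limit; the resulting bound is uniform in K and yields summability and the norm estimate
  together.\<close>

lemma
  assumes M: "bounded_matrix M C" and x: "sqs x"
  shows sqs_mv: "sqs (mv M x)" and l2_norm_mv: "l2_norm (mv M x) \<le> C * l2_norm x"
proof -
  have C: "0 \<le> C" by (rule bounded_matrix_nonneg[OF M])
  have "(\<Sum>k<K. (mv M x k)\<^sup>2) \<le> (C * l2_norm x)\<^sup>2" for K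
  proof (rule LIMSEQ_le_const2)
    show "(\<lambda>N. \<Sum>k<K. (\<Sum>n<N. M k n * x n)\<^sup>2) \<longlonglongrightarrow> (\<Sum>k<K. (mv M x k)\<^sup>2)"
      using mv_sums[OF M x] unfolding sums_def by (intro tendsto_sum tendsto_power) auto
    have "(\<Sum>k<K. (\<Sum>n<N. M k n * x n)\<^sup>2) \<le> (C * l2_norm x)\<^sup>2" for N
    proof -
      have "(\<Sum>k<K. (\<Sum>n<N. M k n * x n)\<^sup>2) \<le> C\<^sup>2 * (\<Sum>n<N. (x n)\<^sup>2)"
        by (rule bounded_matrixD[OF M])
      also have "\<dots> \<le> C\<^sup>2 * (\<Sum>n. (x n)\<^sup>2)" by (intro mult_left_mono sum_le_suminf x) auto
      finally show ?thesis by (simp add: power_mult_distrib l2_norm_sq[OF x])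
    qed
    then show "\<exists>N0. \<forall>N\<ge>N0. (\<Sum>k<K. (\<Sum>n<N. M k n * x n)\<^sup>2) \<le> (C * l2_norm x)\<^sup>2" by blast
  qed
  moreover have "0 \<le> C * l2_norm x" using C x by (simp add: l2_norm_nonneg)
  ultimately show "sqs (mv M x)" "l2_norm (mv M x) \<le> C * l2_norm x" using sqs_bound by blast+
qed

lemma mv_add: "bounded_matrix M C \<Longrightarrow> sqs x \<Longrightarrow> sqs y \<Longrightarrow> mv M (\<lambda>n. x n + y n) k = mv M x k + mv M y k"
  unfolding mv_ip by (rule ip_add_right[OF bounded_matrix_row])

lemma mv_cmult: "bounded_matrix M C \<Longrightarrow> sqs x \<Longrightarrow> mv M (\<lambda>n. c * x n) k = c * mv M x k"
  unfolding mv_ip by (rule ip_cmult_right[OF bounded_matrix_row])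

lemma mv_diff: "bounded_matrix M C \<Longrightarrow> sqs x \<Longrightarrow> sqs y \<Longrightarrow> mv M (\<lambda>n. x n - y n) k = mv M x k - mv M y k"
  using mv_add[of M C x "\<lambda>n. (-1) * y n" k] mv_cmult[of M C y "-1" k] sqs_cmult[of y "-1"] by simp

text \<open>The double series need not converge absolutely, so the sums cannot simply be
  interchanged. Cutting x off at N leaves finitely many columns, for which the interchange is
  additivity of series; the tail \<open>t N\<close> contributes at most |y| C |t N|, which tends to
  0.\<close>

lemma ip_mv:
  assumes M: "bounded_matrix M C" and x: "sqs x" and y: "sqs y"
  shows "ip (mv M x) y = ip x (mv (tr M) y)"
proof -
  have "(\<lambda>N. \<Sum>n<N. x n * mv (tr M) y n) \<longlonglongrightarrow> ip (mv M x) y"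
  proof (rule Lim_transform2[of "\<lambda>_. ip (mv M x) y"])
    define t where "t N n = (if n < N then 0 else x n)" for N n
    define f where "f N n = (if n < N then x n else 0)" for N n
    have t: "sqs (t N)" and f: "sqs (f N)" for N
      by (rule sqs_dominated_scale[OF x, of _ 1]; simp add: t_def f_def)+
    have "ip (mv M x) y - (\<Sum>n<N. x n * mv (tr M) y n) = ip y (mv M (t N))" for N
    proof -
      have mvf: "mv M (f N) k = (\<Sum>n<N. M k n * x n)" for k
      proof -
        have "(\<lambda>n. if n \<in> {..<N} then M k n * x n else 0) sums (\<Sum>n<N. M k n * x n)"
          by (rule sums_If_finite_set) simp
        moreover have "(\<lambda>n. if n \<in> {..<N} then M k n * x n else 0) = (\<lambda>n. M k n * f N n)"
          by (auto simp: f_def)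
        ultimately show ?thesis by (simp add: mv_def sums_iff)
      qed
      have "(\<lambda>k. \<Sum>n<N. x n * (M k n * y k)) sums (\<Sum>n<N. x n * mv (tr M) y n)"
        by (intro sums_sum sums_mult mv_sums[OF bounded_matrix_tr[OF M] y])
      then have "ip y (mv M (f N)) = (\<Sum>n<N. x n * mv (tr M) y n)"
        unfolding ip_def mvf by (simp add: sum_distrib_left mult_ac sums_iff)
      moreover have "mv M x = (\<lambda>k. mv M (f N) k + mv M (t N) k)"
      proof
        fix k
        have "(\<lambda>n. f N n + t N n) = x" by (auto simp: f_def t_def)
        with mv_add[OF M f[of N] t[of N], of k] show "mv M x k = mv M (f N) k + mv M (t N) k" by simp
      qed
      ultimately show ?thesis
        using ip_add_right[OF y sqs_mv[OF M f[of N]] sqs_mv[OF M t[of N]]] by (simp add: ip_commute)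
    qed
    moreover have "(\<lambda>N. ip y (mv M (t N))) \<longlonglongrightarrow> 0"
    proof (rule Lim_null_comparison)
      show "\<forall>\<^sub>F N in sequentially. norm (ip y (mv M (t N))) \<le> l2_norm y * (C * l2_norm (t N))"
      proof (intro always_eventually allI)
        fix N
        have "norm (ip y (mv M (t N))) \<le> l2_norm y * l2_norm (mv M (t N))"
          using ip_Cauchy_Schwarz[OF y sqs_mv[OF M t]] by simp
        also have "\<dots> \<le> l2_norm y * (C * l2_norm (t N))"
          by (intro mult_left_mono l2_norm_mv[OF M t] l2_norm_nonneg y)
        finally show "norm (ip y (mv M (t N))) \<le> l2_norm y * (C * l2_norm (t N))" .
      qed
      show "(\<lambda>N. l2_norm y * (C * l2_norm (t N))) \<longlonglongrightarrow> 0"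
        using tendsto_mult[OF tendsto_const[of "l2_norm y * C"] l2_norm_tail[OF x]]
        unfolding t_def by (simp add: mult.assoc)
    qed
    ultimately show "(\<lambda>N. ip (mv M x) y - (\<Sum>n<N. x n * mv (tr M) y n)) \<longlonglongrightarrow> 0" by simp
  qed simp
  then show ?thesis unfolding ip_def[of x] by (simp add: sums_iff sums_def[symmetric])
qed

text \<open>Cauchy-Schwarz with S = sqrt S * sqrt S: one factor is absorbed by the row sum, the
  other leaves a weight on x^2 whose sum over k is a column sum.\<close>

lemma schur_test:
  assumes nonneg: "\<And>k n. 0 \<le> S k n" and C: "0 \<le> C"
    and row: "\<And>k N. (\<Sum>n<N. S k n) \<le> C" and col: "\<And>n K. (\<Sum>k<K. S k n) \<le> C"
  shows "bounded_matrix S C"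
  unfolding bounded_matrix_def
proof (intro conjI allI C)
  fix K N x
  have "(\<Sum>n<N. S k n * x n)\<^sup>2 \<le> C * (\<Sum>n<N. S k n * (x n)\<^sup>2)" for k
  proof -
    let ?s = "\<lambda>n. sqrt (S k n)"
    have "\<bar>\<Sum>n<N. S k n * x n\<bar> \<le> (\<Sum>n<N. \<bar>?s n\<bar> * \<bar>?s n * x n\<bar>)"
      by (rule order.trans[OF sum_abs]) (simp add: abs_mult nonneg flip: mult.assoc)
    also have "\<dots> \<le> L2_set ?s {..<N} * L2_set (\<lambda>n. ?s n * x n) {..<N}" by (rule L2_set_mult_ineq)
    finally have "\<bar>\<Sum>n<N. S k n * x n\<bar>\<^sup>2 \<le> (L2_set ?s {..<N} * L2_set (\<lambda>n. ?s n * x n) {..<N})\<^sup>2"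
      by (rule power_mono) simp
    also have "\<dots> = (\<Sum>n<N. S k n) * (\<Sum>n<N. S k n * (x n)\<^sup>2)"
      by (simp add: L2_set_def power_mult_distrib nonneg sum_nonneg)
    also have "\<dots> \<le> C * (\<Sum>n<N. S k n * (x n)\<^sup>2)"
      by (intro mult_right_mono row sum_nonneg) (simp add: nonneg)
    finally show ?thesis by simp
  qed
  then have "(\<Sum>k<K. (\<Sum>n<N. S k n * x n)\<^sup>2) \<le> (\<Sum>k<K. C * (\<Sum>n<N. S k n * (x n)\<^sup>2))"
    by (intro sum_mono)
  also have "\<dots> = C * (\<Sum>n<N. (\<Sum>k<K. S k n) * (x n)\<^sup>2)"
    unfolding sum_distrib_left[symmetric] sum_distrib_right by (subst sum.swap) simp
  also have "\<dots> \<le> C * (\<Sum>n<N. C * (x n)\<^sup>2)"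
    by (intro mult_left_mono sum_mono mult_right_mono col C) auto
  finally show "(\<Sum>k<K. (\<Sum>n<N. S k n * x n)\<^sup>2) \<le> C\<^sup>2 * (\<Sum>n<N. (x n)\<^sup>2)"
    by (simp add: sum_distrib_left power2_eq_square mult_ac)
qed

section \<open>Exact sums of the coefficients: telescoping and partial fractions\<close>

lemma half_plus_nonzero: "real n + 1/2 + real k \<noteq> 0" "real n + 1/2 - real k \<noteq> 0"
proof -
  have "2 * (int n - int k) + 1 \<noteq> 0" by presburger
  then have "real_of_int (2 * (int n - int k) + 1) \<noteq> 0" by linarith
  then show "real n + 1/2 - real k \<noteq> 0" by simp
qed linarith

lemma a_coeff_alt: "a_coeff k n = 1 / (real n + 1/2 + real k) + 1 / (real n + 1/2 - real k)"
  by (simp add: a_coeff_def algebra_simps)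

lemma a_coeff_closed: "a_coeff k n = 2 * (real n + 1/2) / ((real n + 1/2)\<^sup>2 - (real k)\<^sup>2)"
proof -
  define N where "N = real n + 1/2"
  have "N + real k \<noteq> 0" "N - real k \<noteq> 0"
    unfolding N_def using half_plus_nonzero[of n k] by auto
  then show ?thesis
    unfolding a_coeff_alt N_def[symmetric] power2_eq_square square_diff_square_factored
    by (simp add: divide_simps)
qed

lemma half_square_nonzero: "(real n + 1/2)\<^sup>2 - (real k)\<^sup>2 \<noteq> 0"
  using half_plus_nonzero[of n k] unfolding power2_eq_square square_diff_square_factored by simp

lemma partial_fractions: "E \<noteq> 0 \<Longrightarrow> F \<noteq> 0 \<Longrightarrow> E \<noteq> F \<Longrightarrow> (c / E - c / F) / (F - E) = c / (E * F)" for c :: real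
  by (simp add: divide_simps) (simp add: algebra_simps)

text \<open>Raising n by one shifts both fractions by one place in j, so the change is a sum of two
  telescoping series, of which only the boundary terms - 1/(n + 3/2) and 1/(n + 1/2) survive. For n
  = 0 the column telescopes by itself.\<close>

lemma sums_a_coeff_column: "(\<lambda>j. a_coeff (Suc j) n) sums (- 1 / (real n + 1/2))"
proof (induction n)
  case 0
  have "(\<lambda>j. 1 / (real j + 1/2)) \<longlonglongrightarrow> 0" by real_asymp
  from telescope_sums[OF this]
  have "(\<lambda>j. 1 / (real j + 3/2) - 1 / (real j + 1/2)) sums - 2" by (simp add: algebra_simps)
  moreover have "a_coeff (Suc j) 0 = 1 / (real j + 3/2) - 1 / (real j + 1/2)" for j
  proof -
    have "1 / (- (1/2) - real j) = - (1 / (real j + 1/2))"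
      by (metis minus_diff_eq minus_divide_right diff_minus_eq_add add.commute)
    then show ?thesis by (simp add: a_coeff_def algebra_simps)
  qed
  ultimately show ?case by simp
next
  case (Suc n)
  have "(\<lambda>j. 1 / (real n + 1/2 + (real j + 1))) \<longlonglongrightarrow> 0" by real_asymp
  from telescope_sums[OF this] have
    "(\<lambda>j. 1 / (real n + 1/2 + (real j + 2)) - 1 / (real n + 1/2 + (real j + 1)))
      sums (- 1 / (real n + 3/2))" by (simp add: algebra_simps)
  moreover have "(\<lambda>j. 1 / (real n + 1/2 - real j)) \<longlonglongrightarrow> 0" by real_asymp
  from telescope_sums'[OF this] have
    "(\<lambda>j. 1 / (real n + 1/2 - real j) - 1 / (real n + 1/2 - (real j + 1)))
      sums (1 / (real n + 1/2))" by (simp add: algebra_simps)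
  ultimately have "(\<lambda>j. a_coeff (Suc j) n
      + (1 / (real n + 1/2 + (real j + 2)) - 1 / (real n + 1/2 + (real j + 1))
      + (1 / (real n + 1/2 - real j) - 1 / (real n + 1/2 - (real j + 1)))))
      sums (- 1 / (real n + 1/2) + (- 1 / (real n + 3/2) + 1 / (real n + 1/2)))"
    by (intro sums_add Suc.IH)
  then show ?case by (simp add: a_coeff_def algebra_simps)
qed

text \<open>The same shift argument in k. The sum starts at n = 0, although sequences start at index
  1: with this term included it vanishes for every k, and the correction is deferred to
  \<open>v_vec\<close>.\<close>

lemma sums_diff_row: "(\<lambda>n. 1 / (real n + 1/2 - real k) - 1 / (real n + 1/2 + real k)) sums 0"
proof (induction k)
  case (Suc k)
  have "(\<lambda>n. 1 / (real n - 1/2 - real k)) \<longlonglongrightarrow> 0" by real_asymp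
  from telescope_sums'[OF this] have
    "(\<lambda>n. 1 / (real n - 1/2 - real k) - 1 / (real n + 1/2 - real k)) sums (1 / (- 1/2 - real k))"
    by (simp add: algebra_simps)
  also have "1 / (- 1/2 - real k) = - 1 / (real k + 1/2)" by (simp add: divide_simps)
  finally have "(\<lambda>n. 1 / (real n - 1/2 - real k) - 1 / (real n + 1/2 - real k)) sums (- 1 / (real k + 1/2))" .
  moreover have "(\<lambda>n. 1 / (real n + 1/2 + real k)) \<longlonglongrightarrow> 0" by real_asymp
  from telescope_sums'[OF this] have
    "(\<lambda>n. 1 / (real n + 1/2 + real k) - 1 / (real n + 3/2 + real k)) sums (1 / (real k + 1/2))"
    by (simp add: algebra_simps)
  ultimately have "(\<lambda>n. (1 / (real n + 1/2 - real k) - 1 / (real n + 1/2 + real k))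
      + ((1 / (real n - 1/2 - real k) - 1 / (real n + 1/2 - real k))
      + (1 / (real n + 1/2 + real k) - 1 / (real n + 3/2 + real k))))
      sums (0 + (- 1 / (real k + 1/2) + 1 / (real k + 1/2)))"
    by (intro sums_add Suc.IH)
  then show ?case by (simp add: algebra_simps)
qed simp

text \<open>The Basel series grouped in pairs 2m + 1, 2m + 2: the even squares contribute a quarter
  of pi^2/6, and the odd ones, rescaled by 4, are the series wanted.\<close>

lemma sums_inverse_half_squares: "(\<lambda>j. 1 / (real j + 1/2)\<^sup>2) sums (pi\<^sup>2 / 2)"
proof -
  have "(\<lambda>m. \<Sum>n = m * 2..<m * 2 + 2. 1 / (real n + 1)\<^sup>2) sums (pi\<^sup>2 / 6)"
    using sums_group[OF inverse_squares_sums, of 2] by (simp add: add.commute)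
  moreover have "(\<Sum>n = m * 2..<m * 2 + 2. 1 / (real n + 1)\<^sup>2)
      = 1/4 * (1 / (real m + 1/2)\<^sup>2) + 1/4 * (1 / (real m + 1)\<^sup>2)" for m
  proof -
    have "{m * 2..<m * 2 + 2} = {m * 2, m * 2 + 1}" by auto
    then have "(\<Sum>n = m * 2..<m * 2 + 2. 1 / (real n + 1)\<^sup>2)
      = 1 / (2 * (real m + 1/2))\<^sup>2 + 1 / (2 * (real m + 1))\<^sup>2" by (simp add: algebra_simps)
    then show ?thesis by (simp only: power_mult_distrib) simp
  qed
  moreover have "(\<lambda>m. 1/4 * (1 / (real m + 1)\<^sup>2)) sums (1/4 * (pi\<^sup>2 / 6))"
    using sums_mult[OF inverse_squares_sums, of "1/4"] by (simp add: add.commute)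
  ultimately have "(\<lambda>m. 1/4 * (1 / (real m + 1/2)\<^sup>2)) sums (pi\<^sup>2 / 6 - 1/4 * (pi\<^sup>2 / 6))"
    using sums_diff by fastforce
  from sums_mult[OF this, of 4] show ?thesis by simp
qed

text \<open>With N = n + 1/2 this is the sum of 1/(N - k)^2 over all nonzero integers k. Over all
  integers it would be (pi / sin(pi N))^2 = pi^2; the subtracted term is the one for k = 0. The
  proof needs only the shift from n to n + 1.\<close>

lemma sums_squares_column:
  "(\<lambda>j. 1 / (real n + 1/2 + real (Suc j))\<^sup>2 + 1 / (real n + 1/2 - real (Suc j))\<^sup>2)
    sums (pi\<^sup>2 - 1 / (real n + 1/2)\<^sup>2)"
proof (induction n)
  case 0
  have "(\<lambda>j. 1 / (real (Suc j) + 1/2)\<^sup>2) sums (pi\<^sup>2 / 2 - 4)"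
    using sums_inverse_half_squares by (subst sums_Suc_iff) (simp add: power2_eq_square)
  from sums_add[OF this sums_inverse_half_squares]
  have "(\<lambda>j. 1 / (real (Suc j) + 1/2)\<^sup>2 + 1 / (real j + 1/2)\<^sup>2) sums (pi\<^sup>2 - 4)" by simp
  moreover have "(1/2 + real (Suc j))\<^sup>2 = (real (Suc j) + 1/2)\<^sup>2" "(1/2 - real (Suc j))\<^sup>2 = (real j + 1/2)\<^sup>2" for j
    by (simp_all add: power2_eq_square algebra_simps)
  ultimately show ?case by (simp add: power2_eq_square[of "1/2::real"])
next
  case (Suc n)
  have "(\<lambda>j. 1 / (real n + 1/2 + (real j + 1))\<^sup>2) \<longlonglongrightarrow> 0" by real_asymp
  from telescope_sums[OF this] have
    "(\<lambda>j. 1 / (real n + 1/2 + (real j + 2))\<^sup>2 - 1 / (real n + 1/2 + (real j + 1))\<^sup>2)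
      sums (- 1 / (real n + 3/2)\<^sup>2)" by (simp add: algebra_simps)
  moreover have "(\<lambda>j. 1 / (real n + 1/2 - real j)\<^sup>2) \<longlonglongrightarrow> 0" by real_asymp
  from telescope_sums'[OF this] have
    "(\<lambda>j. 1 / (real n + 1/2 - real j)\<^sup>2 - 1 / (real n + 1/2 - (real j + 1))\<^sup>2)
      sums (1 / (real n + 1/2)\<^sup>2)" by (simp add: algebra_simps)
  ultimately have "(\<lambda>j. (1 / (real n + 1/2 + real (Suc j))\<^sup>2 + 1 / (real n + 1/2 - real (Suc j))\<^sup>2)
      + (1 / (real n + 1/2 + (real j + 2))\<^sup>2 - 1 / (real n + 1/2 + (real j + 1))\<^sup>2
      + (1 / (real n + 1/2 - real j)\<^sup>2 - 1 / (real n + 1/2 - (real j + 1))\<^sup>2)))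
      sums (pi\<^sup>2 - 1 / (real n + 1/2)\<^sup>2 + (- 1 / (real n + 3/2)\<^sup>2 + 1 / (real n + 1/2)\<^sup>2))"
    by (intro sums_add Suc.IH)
  then show ?case by (simp add: algebra_simps)
qed

text \<open>Up to sign, n + 1/2 runs through all half-integers, so this is the sum of 1/(h - k)^2
  over all half-integers h, which does not change when k is shifted.\<close>

lemma sums_squares_row:
  "(\<lambda>n. 1 / (real n + 1/2 + real k)\<^sup>2 + 1 / (real n + 1/2 - real k)\<^sup>2) sums pi\<^sup>2"
proof (induction k)
  case 0
  from sums_add[OF sums_inverse_half_squares sums_inverse_half_squares] show ?case by simp
next
  case (Suc k)
  have "(\<lambda>n. 1 / (real n - 1/2 - real k)\<^sup>2) \<longlonglongrightarrow> 0" by real_asymp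
  from telescope_sums'[OF this] have
    "(\<lambda>n. 1 / (real n - 1/2 - real k)\<^sup>2 - 1 / (real n + 1/2 - real k)\<^sup>2) sums (1 / (- 1/2 - real k)\<^sup>2)"
    by (simp add: algebra_simps)
  also have "(- 1/2 - real k)\<^sup>2 = (real k + 1/2)\<^sup>2" by (simp add: power2_eq_square algebra_simps)
  finally have t1: "(\<lambda>n. 1 / (real n - 1/2 - real k)\<^sup>2 - 1 / (real n + 1/2 - real k)\<^sup>2) sums (1 / (real k + 1/2)\<^sup>2)" .
  have "(\<lambda>n. 1 / (real n + 1/2 + real k)\<^sup>2) \<longlonglongrightarrow> 0" by real_asymp
  from telescope_sums'[OF this] have
t2: "(\<lambda>n. 1 / (real n + 1/2 + real k)\<^sup>2 - 1 / (real n + 3/2 + real k)\<^sup>2) sums (1 / (real k + 1/2)\<^sup>2)"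
    by (simp add: algebra_simps)
  have "(\<lambda>n. (1 / (real n + 1/2 + real k)\<^sup>2 + 1 / (real n + 1/2 - real k)\<^sup>2)
      + ((1 / (real n - 1/2 - real k)\<^sup>2 - 1 / (real n + 1/2 - real k)\<^sup>2)
      - (1 / (real n + 1/2 + real k)\<^sup>2 - 1 / (real n + 3/2 + real k)\<^sup>2)))
      sums (pi\<^sup>2 + (1 / (real k + 1/2)\<^sup>2 - 1 / (real k + 1/2)\<^sup>2))"
    by (rule sums_add[OF Suc.IH sums_diff[OF t1 t2]])
  moreover have "pi\<^sup>2 + (1 / (real k + 1/2)\<^sup>2 - 1 / (real k + 1/2)\<^sup>2) = pi\<^sup>2" by simp
  ultimately show ?case by (simp add: algebra_simps)
qed

text \<open>On the diagonal, the cross term of the squared entry is \<open>a_coeff\<close> divided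
  by n + 1/2; off the diagonal, partial fractions turn the product into a combination of two single
  columns. Both cases thus reduce to sums already known.\<close>

lemma sums_gram_column:
  "(\<lambda>j. a_coeff (Suc j) n * a_coeff (Suc j) m) sums
    ((if n = m then pi\<^sup>2 else 0) - 2 / ((real n + 1/2) * (real m + 1/2)))"
proof (cases "n = m")
  case True
  let ?N = "real m + 1/2"
  have "(1 / (?N + real (Suc j))\<^sup>2 + 1 / (?N - real (Suc j))\<^sup>2) + 1 / ?N * a_coeff (Suc j) m
      = a_coeff (Suc j) m * a_coeff (Suc j) m" for j
  proof -
    define k where "k = real (Suc j)"
    have "?N + k \<noteq> 0" "?N - k \<noteq> 0" "?N \<noteq> 0"
      unfolding k_def using half_plus_nonzero[of m "Suc j"] by auto
    then show ?thesis
      unfolding a_coeff_alt k_def[symmetric]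
      by (simp add: divide_simps power2_eq_square) (simp add: algebra_simps)
  qed
  then have "(\<lambda>j. a_coeff (Suc j) m * a_coeff (Suc j) m) sums
      (pi\<^sup>2 - 1 / ?N\<^sup>2 + 1 / ?N * (- 1 / ?N))"
    using sums_add[OF sums_squares_column[of m] sums_mult[OF sums_a_coeff_column[of m], of "1 / ?N"]] by simp
  then show ?thesis using True by (simp add: power2_eq_square)
next
  case False
  let ?N = "real n + 1/2" and ?M = "real m + 1/2"
  have d: "?M\<^sup>2 - ?N\<^sup>2 \<noteq> 0" using False by (simp add: power2_eq_iff)
  have "1 / (?M\<^sup>2 - ?N\<^sup>2) * (2 * ?M * a_coeff (Suc j) n - 2 * ?N * a_coeff (Suc j) m)
      = a_coeff (Suc j) n * a_coeff (Suc j) m" for j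
    using partial_fractions[OF half_square_nonzero[of n "Suc j"] half_square_nonzero[of m "Suc j"],
        of "2 * ?N * (2 * ?M)"] d
    unfolding a_coeff_closed by (simp add: mult.commute)
  moreover have "(\<lambda>j. 1 / (?M\<^sup>2 - ?N\<^sup>2) * (2 * ?M * a_coeff (Suc j) n - 2 * ?N * a_coeff (Suc j) m)) sums
     (1 / (?M\<^sup>2 - ?N\<^sup>2) * (2 * ?M * (- 1 / ?N) - 2 * ?N * (- 1 / ?M)))"
    by (intro sums_mult sums_diff sums_a_coeff_column)
  moreover have "1 / (?M\<^sup>2 - ?N\<^sup>2) * (2 * ?M * (- 1 / ?N) - 2 * ?N * (- 1 / ?M)) = - 2 / (?N * ?M)"
  proof -
    have "1 / (M\<^sup>2 - N\<^sup>2) * (2 * M * (- 1 / N) - 2 * N * (- 1 / M)) = - 2 / (N * M)"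
      if "N \<noteq> 0" "M \<noteq> 0" "M\<^sup>2 - N\<^sup>2 \<noteq> 0" for N M :: real
    proof -
      have "2 * M * (- 1 / N) - 2 * N * (- 1 / M) = - 2 / (N * M) * (M\<^sup>2 - N\<^sup>2)"
        using that by (simp add: field_simps power2_eq_square)
      then have "1 / (M\<^sup>2 - N\<^sup>2) * (2 * M * (- 1 / N) - 2 * N * (- 1 / M))
        = 1 / (M\<^sup>2 - N\<^sup>2) * (- 2 / (N * M) * (M\<^sup>2 - N\<^sup>2))" by (rule arg_cong)
      also have "1 / X * (c * X) = c" if "X \<noteq> 0" for X c :: real using that by simp
      note this[OF that(3)]
      finally show ?thesis .
    qed
    from this[of ?N ?M] d show ?thesis by simp
  qed
  ultimately show ?thesis using False by simp
qed

text \<open>The sum of a single row diverges, so partial fractions go through the differences 1/(N -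
  k) - 1/(N + k), N = n + 1/2, whose sums vanish. Times k, such a difference is 2 (N^2 / (N^2 - k^2)
  - 1), and the constants cancel between k and j. On the diagonal the cross term of the square is
  this difference divided by k.\<close>

lemma sums_gram_row:
  assumes "k \<noteq> 0" "j \<noteq> 0"
  shows "(\<lambda>n. a_coeff k n * a_coeff j n) sums (if k = j then pi\<^sup>2 else 0)"
proof (cases "k = j")
  case True
  have "(1 / (real n + 1/2 + real k)\<^sup>2 + 1 / (real n + 1/2 - real k)\<^sup>2)
      + 1 / real k * (1 / (real n + 1/2 - real k) - 1 / (real n + 1/2 + real k))
      = a_coeff k n * a_coeff k n" for n
  proof -
    define N where "N = real n + 1/2"
    have "N + real k \<noteq> 0" "N - real k \<noteq> 0"
      unfolding N_def using half_plus_nonzero[of n k] by auto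
    then show ?thesis
      unfolding a_coeff_alt N_def[symmetric] using assms
      by (simp add: divide_simps power2_eq_square) (simp add: algebra_simps)
  qed
  then show ?thesis
    using sums_add[OF sums_squares_row[of k] sums_mult[OF sums_diff_row[of k], of "1 / real k"]] True by simp
next
  case False
  let ?D = "\<lambda>k n. 1 / (real n + 1/2 - real k) - 1 / (real n + 1/2 + real k)"
  have d: "(real k)\<^sup>2 - (real j)\<^sup>2 \<noteq> 0" using False by (simp add: power2_eq_iff)
  have "2 / ((real k)\<^sup>2 - (real j)\<^sup>2) * (real k * ?D k n - real j * ?D j n) = a_coeff k n * a_coeff j n" for n
  proof -
    define N where "N = real n + 1/2"
    define E where "E k = N\<^sup>2 - (real k)\<^sup>2" for k
    have E: "E k \<noteq> 0" for k using half_square_nonzero by (simp add: E_def N_def)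
    have D: "real k * ?D k n = 2 * (N\<^sup>2 / E k - 1)" for k
    proof -
      have "N + real k \<noteq> 0" "N - real k \<noteq> 0"
        unfolding N_def using half_plus_nonzero[of n k] by auto
      then have "?D k n = 2 * real k / E k"
        unfolding N_def[symmetric] E_def power2_eq_square square_diff_square_factored
        by (simp add: divide_simps)
      moreover have "real k * real k = N\<^sup>2 - E k" by (simp add: E_def power2_eq_square)
      ultimately have "real k * ?D k n = 2 * (N\<^sup>2 - E k) / E k" by (simp add: mult.left_commute)
      then show ?thesis using E[of k] by (simp add: diff_divide_distrib)
    qed
    have "E k \<noteq> E j" "(real k)\<^sup>2 - (real j)\<^sup>2 = E j - E k" using d by (auto simp: E_def)
    have "2 / X * (2 * (N\<^sup>2 / e - 1) - 2 * (N\<^sup>2 / f - 1)) = (2 * N * (2 * N) / e - 2 * N * (2 * N) / f) / X"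
      for X e f :: real
      by (simp add: power2_eq_square algebra_simps diff_divide_distrib)
    then show ?thesis
      using partial_fractions[OF E[of k] E[of j] \<open>E k \<noteq> E j\<close>, of "2 * N * (2 * N)"]
      unfolding D unfolding a_coeff_closed N_def[symmetric] E_def[symmetric] \<open>_ = E j - E k\<close> by (simp add: power2_eq_square)
  qed
  moreover have "(\<lambda>n. 2 / ((real k)\<^sup>2 - (real j)\<^sup>2) * (real k * ?D k n - real j * ?D j n)) sums
    (2 / ((real k)\<^sup>2 - (real j)\<^sup>2) * (real k * 0 - real j * 0))"
    by (intro sums_mult sums_diff sums_diff_row)
  ultimately show ?thesis using False by simp
qed

section \<open>Gram identities of A\<close>

definition A_matrix :: "nat \<Rightarrow> nat \<Rightarrow> real" where
  "A_matrix k n = (if k = 0 \<or> n = 0 then 0 else a_coeff k n)"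

text \<open>Half the row k = 0 of \<open>a_coeff\<close>. The entries are even in k and the columns
  are orthogonal over all integers k; restricting to k >= 1 therefore removes half of (2 u)(2 u)^T,
  which is 2 u u^T.\<close>

definition u_vec :: "nat \<Rightarrow> real" where
  "u_vec n = (if n = 0 then 0 else 1 / (real n + 1/2))"

text \<open>The column n = 0, which sequences indexed from 1 leave out: the rows are orthogonal when
  n starts at 0, so its removal subtracts v v^T.\<close>

definition v_vec :: "nat \<Rightarrow> real" where
  "v_vec k = (if k = 0 then 0 else a_coeff k 0)"

lemma sums_from_Suc: "(\<lambda>j. f (Suc j)) sums s \<Longrightarrow> f 0 = 0 \<Longrightarrow> f sums s" for f :: "nat \<Rightarrow> real"
  using sums_Suc[of f s] by simp

lemma sums_drop_zero: "f sums s \<Longrightarrow> f 0 = 0 \<Longrightarrow> (\<lambda>j. f (Suc j)) sums s" for f :: "nat \<Rightarrow> real"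
  by (subst sums_Suc_iff) simp

lemma A_matrix_gram_column:
  "(\<lambda>k. A_matrix k n * A_matrix k m) sums ((if n = m \<and> n \<noteq> 0 then pi\<^sup>2 else 0) - 2 * u_vec n * u_vec m)"
proof (cases "n = 0 \<or> m = 0")
  case True
  then show ?thesis by (auto simp: A_matrix_def u_vec_def)
next
  case False
  then show ?thesis
    using sums_gram_column[of n m]
    by - (rule sums_from_Suc, simp_all add: A_matrix_def u_vec_def)
qed

lemma A_matrix_gram_row:
  "(\<lambda>n. A_matrix k n * A_matrix j n) sums ((if k = j \<and> k \<noteq> 0 then pi\<^sup>2 else 0) - v_vec k * v_vec j)"
proof (cases "k = 0 \<or> j = 0")
  case True
  then show ?thesis by (auto simp: A_matrix_def v_vec_def)
next
  case False
  then have "(\<lambda>n. a_coeff k n * a_coeff j n) sums (if k = j then pi\<^sup>2 else 0)"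
    using sums_gram_row by blast
  then have "(\<lambda>n. a_coeff k (Suc n) * a_coeff j (Suc n)) sums
      ((if k = j then pi\<^sup>2 else 0) - a_coeff k 0 * a_coeff j 0)"
    by (subst sums_Suc_iff) simp
  moreover have "A_matrix k (Suc n) * A_matrix j (Suc n) = a_coeff k (Suc n) * a_coeff j (Suc n)" for n
    using False by (simp add: A_matrix_def)
  moreover have "(if k = j \<and> k \<noteq> 0 then pi\<^sup>2 else 0) - v_vec k * v_vec j
      = (if k = j then pi\<^sup>2 else 0) - a_coeff k 0 * a_coeff j 0"
    using False by (simp add: v_vec_def)
  ultimately show ?thesis
    by - (rule sums_from_Suc, simp_all only: A_matrix_def simp_thms if_True mult_zero_left)
qed

lemma u_vec_sums: "(\<lambda>n. (u_vec n)\<^sup>2) sums (pi\<^sup>2 / 2 - 4)"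
proof (rule sums_from_Suc)
  have "(\<lambda>n. 1 / (real (Suc n) + 1/2)\<^sup>2) sums (pi\<^sup>2 / 2 - 4)"
    using sums_inverse_half_squares by (subst sums_Suc_iff) (simp add: power2_eq_square)
  then show "(\<lambda>n. (u_vec (Suc n))\<^sup>2) sums (pi\<^sup>2 / 2 - 4)"
    by (simp add: u_vec_def power_divide)
qed (simp add: u_vec_def)

lemma v_vec_sums: "(\<lambda>k. (v_vec k)\<^sup>2) sums (pi\<^sup>2 - 8)"
  using sums_gram_column[of 0 0]
  by - (rule sums_from_Suc, simp_all add: v_vec_def power2_eq_square)

lemma u_vec_sqs: "sqs u_vec" and u_vec_norm: "(l2_norm u_vec)\<^sup>2 = pi\<^sup>2 / 2 - 4"
  using u_vec_sums l2_norm_sq[of u_vec] by (auto simp: sums_iff)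

lemma v_vec_sqs: "sqs v_vec" and v_vec_norm: "(l2_norm v_vec)\<^sup>2 = pi\<^sup>2 - 8"
  using v_vec_sums l2_norm_sq[of v_vec] by (auto simp: sums_iff)

text \<open>For finitely many columns, the squared norm of A x is a finite combination of Gram
  entries, at most pi^2 |x|^2 minus twice a square, and that square is discarded.\<close>

lemma A_matrix_bounded: "bounded_matrix A_matrix pi"
  unfolding bounded_matrix_def
proof (intro conjI allI)
  fix K N :: nat and x :: "nat \<Rightarrow> real"
  let ?g = "\<lambda>n m. (if n = m \<and> n \<noteq> 0 then pi\<^sup>2 else 0) - 2 * u_vec n * u_vec m"
  have sq: "(\<Sum>n<N. A_matrix k n * x n)\<^sup>2
      = (\<Sum>n<N. \<Sum>m<N. x n * x m * (A_matrix k n * A_matrix k m))" for k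
    unfolding power2_eq_square sum_product by (simp add: mult_ac)
  have "(\<lambda>k. (\<Sum>n<N. A_matrix k n * x n)\<^sup>2) sums (\<Sum>n<N. \<Sum>m<N. x n * x m * ?g n m)"
    unfolding sq by (intro sums_sum sums_mult A_matrix_gram_column)
  then have "(\<Sum>k<K. (\<Sum>n<N. A_matrix k n * x n)\<^sup>2) \<le> (\<Sum>n<N. \<Sum>m<N. x n * x m * ?g n m)"
    using sum_le_suminf[of "\<lambda>k. (\<Sum>n<N. A_matrix k n * x n)\<^sup>2" "{..<K}"] by (simp add: sums_iff)
  also have "\<dots> = (\<Sum>n<N. \<Sum>m<N. x n * x m * (if n = m \<and> n \<noteq> 0 then pi\<^sup>2 else 0))
      - 2 * (\<Sum>n<N. x n * u_vec n)\<^sup>2"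
  proof -
    have "(\<Sum>n<N. \<Sum>m<N. x n * x m * ?g n m) = (\<Sum>n<N. \<Sum>m<N. x n * x m * (if n = m \<and> n \<noteq> 0 then pi\<^sup>2 else 0))
      - (\<Sum>n<N. \<Sum>m<N. 2 * ((x n * u_vec n) * (x m * u_vec m)))"
      unfolding sum_subtractf[symmetric] by (simp only: right_diff_distrib mult_ac)
    also have "(\<Sum>n<N. \<Sum>m<N. 2 * ((x n * u_vec n) * (x m * u_vec m))) = 2 * (\<Sum>n<N. x n * u_vec n)\<^sup>2"
      unfolding power2_eq_square sum_product by (simp only: sum_distrib_left)
    finally show ?thesis .
  qed
  also have "(\<Sum>n<N. \<Sum>m<N. x n * x m * (if n = m \<and> n \<noteq> 0 then pi\<^sup>2 else 0))
      = (\<Sum>n<N. if n = 0 then 0 else pi\<^sup>2 * (x n)\<^sup>2)"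
  proof (rule sum.cong[OF refl])
    fix n assume "n \<in> {..<N}"
    then show "(\<Sum>m<N. x n * x m * (if n = m \<and> n \<noteq> 0 then pi\<^sup>2 else 0)) = (if n = 0 then 0 else pi\<^sup>2 * (x n)\<^sup>2)"
      by (subst sum.mono_neutral_right[of _ "{n}"]) (auto simp: power2_eq_square)
  qed
  also have "\<dots> \<le> (\<Sum>n<N. pi\<^sup>2 * (x n)\<^sup>2)"
    by (intro sum_mono) auto
  also have "\<dots> = pi\<^sup>2 * (\<Sum>n<N. (x n)\<^sup>2)" by (simp add: sum_distrib_left)
  finally show "(\<Sum>k<K. (\<Sum>n<N. A_matrix k n * x n)\<^sup>2) \<le> pi\<^sup>2 * (\<Sum>n<N. (x n)\<^sup>2)"
    by (smt (verit) zero_le_power2)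
qed simp

text \<open>The Gram identity cannot be summed against x entry by entry without interchanging
  limits; \<open>ip_mv\<close>, applied to x and the n-th column, takes care of this.\<close>

lemma A_matrix_tr_A_matrix:
  assumes x: "sqs x" and n: "n \<noteq> 0"
  shows "mv (tr A_matrix) (mv A_matrix x) n = pi\<^sup>2 * x n - 2 * u_vec n * ip u_vec x"
proof -
  have col: "sqs (\<lambda>k. A_matrix k n)" by (rule bounded_matrix_column[OF A_matrix_bounded])
  have "mv (tr A_matrix) (mv A_matrix x) n = ip (mv A_matrix x) (\<lambda>k. A_matrix k n)"
    by (simp add: mv_ip ip_commute)
  also have "\<dots> = ip x (mv (tr A_matrix) (\<lambda>k. A_matrix k n))"
    by (rule ip_mv[OF A_matrix_bounded x col])
  also have "mv (tr A_matrix) (\<lambda>k. A_matrix k n) = (\<lambda>m. (if m = n then pi\<^sup>2 else 0) - 2 * u_vec n * u_vec m)"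
    using A_matrix_gram_column n by (auto simp: mv_def sums_iff fun_eq_iff)
  also have "ip x \<dots> = pi\<^sup>2 * x n - 2 * u_vec n * ip u_vec x"
  proof -
    have "(\<lambda>m. if m = n then x m * pi\<^sup>2 else 0) sums (x n * pi\<^sup>2)"
      by (rule sums_single)
    from sums_diff[OF this sums_mult[OF ip_sums[OF u_vec_sqs x], of "2 * u_vec n"]]
    show ?thesis
      by (simp add: ip_def sums_iff right_diff_distrib mult_ac if_distrib[of "\<lambda>t. _ * t"] cong: if_cong)
  qed
  finally show ?thesis .
qed

lemma A_matrix_A_matrix_tr:
  assumes y: "sqs y" and k: "k \<noteq> 0"
  shows "mv A_matrix (mv (tr A_matrix) y) k = pi\<^sup>2 * y k - v_vec k * ip v_vec y"
proof -
  have row: "sqs (A_matrix k)" by (rule bounded_matrix_row[OF A_matrix_bounded])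
  have "mv A_matrix (mv (tr A_matrix) y) k = ip (A_matrix k) (mv (tr A_matrix) y)"
    by (simp add: mv_ip)
  also have "\<dots> = ip y (mv A_matrix (A_matrix k))"
    using ip_mv[OF A_matrix_bounded row y] by (simp add: ip_commute)
  also have "mv A_matrix (A_matrix k) = (\<lambda>j. (if j = k then pi\<^sup>2 else 0) - v_vec k * v_vec j)"
    using A_matrix_gram_row k by (auto simp: mv_def sums_iff fun_eq_iff mult.commute)
  also have "ip y \<dots> = pi\<^sup>2 * y k - v_vec k * ip v_vec y"
  proof -
    have "(\<lambda>m. if m = k then y m * pi\<^sup>2 else 0) sums (y k * pi\<^sup>2)"
      by (rule sums_single)
    from sums_diff[OF this sums_mult[OF ip_sums[OF v_vec_sqs y], of "v_vec k"]]
    show ?thesis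
      by (simp add: ip_def sums_iff right_diff_distrib mult_ac if_distrib[of "\<lambda>t. _ * t"] cong: if_cong)
  qed
  finally show ?thesis .
qed

section \<open>Invertibility of A and the bound on its inverse\<close>

lemma A_op_eq_mv: assumes "x \<in> l2" shows "A_op x = mv A_matrix x"
proof
  fix k
  have x: "sqs x" using assms by (simp add: l2_def)
  show "A_op x k = mv A_matrix x k"
  proof (cases "k = 0")
    case False
    have "(\<lambda>n. A_matrix k n * x n) sums mv A_matrix x k" by (rule mv_sums[OF A_matrix_bounded x])
    then have "(\<lambda>n. A_matrix k (Suc n) * x (Suc n)) sums mv A_matrix x k"
      by (subst sums_Suc_iff) (simp add: A_matrix_def)
    with False show ?thesis by (simp add: A_op_def A_matrix_def sums_iff)
  qed (simp add: A_op_def mv_def A_matrix_def)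
qed

text \<open>By Cauchy-Schwarz the rank-one term costs at most 2 |u|^2 |x|^2 = (pi^2 - 8) |x|^2, so
  that pi cancels and exactly 8 |x|^2 remains.\<close>

lemma A_op_lower_bound:
  assumes "x \<in> l2" shows "sqrt 8 * l2_norm x \<le> l2_norm (A_op x)"
proof -
  have x: "sqs x" and x0: "x 0 = 0" using assms by (auto simp: l2_def)
  have Ax: "sqs (mv A_matrix x)" by (rule sqs_mv[OF A_matrix_bounded x])
  have "(l2_norm (mv A_matrix x))\<^sup>2 = ip x (mv (tr A_matrix) (mv A_matrix x))"
    using ip_mv[OF A_matrix_bounded x Ax] ip_self[OF Ax] by simp
  also have "\<dots> = pi\<^sup>2 * (l2_norm x)\<^sup>2 - 2 * (ip u_vec x)\<^sup>2"
  proof -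
    have "x n * mv (tr A_matrix) (mv A_matrix x) n = pi\<^sup>2 * (x n * x n) - 2 * ip u_vec x * (u_vec n * x n)" for n
      using x0 by (cases "n = 0") (simp_all add: A_matrix_tr_A_matrix[OF x] algebra_simps)
    moreover have "(\<lambda>n. pi\<^sup>2 * (x n * x n) - 2 * ip u_vec x * (u_vec n * x n)) sums
        (pi\<^sup>2 * ip x x - 2 * ip u_vec x * ip u_vec x)"
      by (intro sums_diff sums_mult ip_sums x u_vec_sqs)
    ultimately show ?thesis
      unfolding ip_self[OF x] by (simp add: ip_def sums_iff power2_eq_square)
  qed
  also have "\<dots> \<ge> pi\<^sup>2 * (l2_norm x)\<^sup>2 - 2 * ((l2_norm u_vec)\<^sup>2 * (l2_norm x)\<^sup>2)"
    using power_mono[OF ip_Cauchy_Schwarz[OF u_vec_sqs x], of 2] by (simp add: power_mult_distrib)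
  finally have "8 * (l2_norm x)\<^sup>2 \<le> (l2_norm (mv A_matrix x))\<^sup>2"
    unfolding u_vec_norm by (simp add: algebra_simps)
  then have "(sqrt 8 * l2_norm x)\<^sup>2 \<le> (l2_norm (mv A_matrix x))\<^sup>2"
    by (simp add: power_mult_distrib)
  then show ?thesis
    unfolding A_op_eq_mv[OF assms] by (rule power2_le_imp_le) (rule l2_norm_nonneg[OF Ax])
qed

lemma l2_diff: "x \<in> l2 \<Longrightarrow> y \<in> l2 \<Longrightarrow> (\<lambda>k. x k - y k) \<in> l2"
  by (auto simp: l2_def sqs_diff)

lemma l2_add: "x \<in> l2 \<Longrightarrow> y \<in> l2 \<Longrightarrow> (\<lambda>k. x k + y k) \<in> l2"
  by (auto simp: l2_def sqs_add)

lemma A_op_diff: "x \<in> l2 \<Longrightarrow> y \<in> l2 \<Longrightarrow> A_op (\<lambda>k. x k - y k) = (\<lambda>k. A_op x k - A_op y k)"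
  unfolding A_op_eq_mv[OF l2_diff] A_op_eq_mv
  by (intro ext mv_diff[OF A_matrix_bounded]) (auto simp: l2_def)

lemma A_op_inj_on: "inj_on A_op l2"
proof (rule inj_onI)
  fix x y assume x: "x \<in> l2" and y: "y \<in> l2" and "A_op x = A_op y"
  then have "l2_norm (A_op (\<lambda>k. x k - y k)) = 0"
    by (simp add: A_op_diff l2_norm_def)
  then have "l2_norm (\<lambda>k. x k - y k) \<le> 0"
    using A_op_lower_bound[OF l2_diff[OF x y]] by (simp add: mult_le_0_iff)
  then have "\<bar>x k - y k\<bar> \<le> 0" for k
    using abs_le_l2_norm[of "\<lambda>k. x k - y k" k] l2_diff[OF x y] by (auto simp: l2_def)
  then show "x = y" by auto
qed

lemma A_op_surj: assumes "y \<in> l2" shows "y \<in> A_op ` l2"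
proof -
  have y: "sqs y" and y0: "y 0 = 0" using assms by (auto simp: l2_def)
  \<comment> \<open>The preimage is sought as A^T z / pi^2 with z = y + c v. Then A A^T z = pi^2 y
    requires c pi^2 = <v, z> = <v, y> + c (pi^2 - 8), which determines c.\<close>
  define c where "c = ip v_vec y / 8"
  define z where "z k = y k + c * v_vec k" for k
  have z: "sqs z" unfolding z_def by (intro sqs_add sqs_cmult y v_vec_sqs)
  define x where "x n = 1 / pi\<^sup>2 * mv (tr A_matrix) z n" for n
  have tz: "sqs (mv (tr A_matrix) z)" by (rule sqs_mv[OF bounded_matrix_tr[OF A_matrix_bounded] z])
  have x: "x \<in> l2"
    using sqs_cmult[OF tz, of "1 / pi\<^sup>2"] by (auto simp: l2_def x_def mv_def A_matrix_def)
  have "ip v_vec z = ip v_vec y + c * (pi\<^sup>2 - 8)"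
    unfolding z_def
    using ip_add_right[OF v_vec_sqs y sqs_cmult[OF v_vec_sqs]] ip_cmult_right[OF v_vec_sqs v_vec_sqs]
    by (simp add: ip_self[OF v_vec_sqs] v_vec_norm)
  then have vz: "ip v_vec z = c * pi\<^sup>2" by (simp add: c_def algebra_simps)
  have "A_op x k = y k" for k
  proof (cases "k = 0")
    case False
    have "A_op x k = 1 / pi\<^sup>2 * mv A_matrix (mv (tr A_matrix) z) k"
      unfolding A_op_eq_mv[OF x] x_def by (rule mv_cmult[OF A_matrix_bounded tz])
    also have "\<dots> = y k"
      unfolding A_matrix_A_matrix_tr[OF z False] vz by (simp add: z_def field_simps)
    finally show ?thesis .
  qed (simp add: A_op_def y0)
  then show ?thesis using x by (metis ext image_eqI)
qed

lemma B_op_l2: "y \<in> l2 \<Longrightarrow> B_op y \<in> l2"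
  unfolding B_op_def by (rule the_inv_into_into[OF A_op_inj_on A_op_surj subset_refl])

lemma A_op_B_op: "y \<in> l2 \<Longrightarrow> A_op (B_op y) = y"
  unfolding B_op_def by (rule f_the_inv_into_f[OF A_op_inj_on A_op_surj])

lemma B_op_norm_le:
  assumes "y \<in> l2" "l2_norm y \<le> c * sqrt 8"
  shows "l2_norm (B_op y) \<le> c"
proof -
  have "sqrt 8 * l2_norm (B_op y) \<le> l2_norm y"
    using A_op_lower_bound[OF B_op_l2[OF assms(1)]] unfolding A_op_B_op[OF assms(1)] .
  also have "\<dots> \<le> sqrt 8 * c" using assms(2) by (simp add: mult.commute)
  finally show ?thesis by (rule mult_left_le_imp_le) simp
qed

lemma B_op_diff:
  assumes "x \<in> l2" "y \<in> l2"
  shows "B_op (\<lambda>k. x k - y k) = (\<lambda>k. B_op x k - B_op y k)"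
proof (rule inj_onD[OF A_op_inj_on])
  show "A_op (B_op (\<lambda>k. x k - y k)) = A_op (\<lambda>k. B_op x k - B_op y k)"
    by (simp add: A_op_diff A_op_B_op B_op_l2 l2_diff assms)
qed (simp_all add: B_op_l2 l2_diff assms)

section \<open>Scalar estimates for the two parts of Q\<close>

definition h_fun :: "real \<Rightarrow> real" where
  "h_fun d = sin (pi * d) / pi - d"

definition s_coeff :: "nat \<Rightarrow> nat \<Rightarrow> real" where
  "s_coeff k n = 1 / (real n + 1/2 + real k)\<^sup>2 + 1 / (real n + 1/2 - real k)\<^sup>2"

definition Q_rem :: "nat \<Rightarrow> nat \<Rightarrow> real \<Rightarrow> real" where
  "Q_rem k n d = Q_int k n d - a_coeff k n * h_fun d"

text \<open>With M = n + 1/2 +- k, each term cos(pi y)/(M - y) - 1/M equals (cos(pi y) - 1)/M +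
  cos(pi y) (1/(M - y) - 1/M). The first summands add up to \<open>a_coeff\<close> times the
  derivative of \<open>h_fun\<close>; the second ones are collected here.\<close>

definition Q_rem_deriv :: "nat \<Rightarrow> nat \<Rightarrow> real \<Rightarrow> real" where
  "Q_rem_deriv k n y = cos (pi * y) *
     (1 / (real n + 1/2 + real k - y) - 1 / (real n + 1/2 + real k)
      + (1 / (real n + 1/2 - real k - y) - 1 / (real n + 1/2 - real k)))"

lemma s_coeff_nonneg: "0 \<le> s_coeff k n"
  by (simp add: s_coeff_def)

lemma half_plus_abs_ge: "1/2 \<le> \<bar>real n + 1/2 + real k\<bar>" "1/2 \<le> \<bar>real n + 1/2 - real k\<bar>"
proof -
  have "1 \<le> \<bar>2 * (int n - int k) + 1\<bar>" by presburger
  then have "1 \<le> \<bar>real_of_int (2 * (int n - int k) + 1)\<bar>" by linarith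
  also have "real_of_int (2 * (int n - int k) + 1) = 2 * (real n + 1/2 - real k)" by simp
  finally show "1/2 \<le> \<bar>real n + 1/2 - real k\<bar>" unfolding abs_mult by simp
qed linarith

text \<open>Since 1 <= 2 |M|, the shift y is at most the fraction 2 |y| of |M|. The bound thereby
  separates into a factor in M and a factor in y, so that a single matrix dominates the remainder
  for all y.\<close>

lemma inverse_shift_bound:
  fixes M y :: real
  assumes "1/2 \<le> \<bar>M\<bar>" "\<bar>y\<bar> < 1/2"
  shows "\<bar>1 / (M - y) - 1 / M\<bar> \<le> 1 / M\<^sup>2 * (\<bar>y\<bar> / (1 - 2 * \<bar>y\<bar>))"
proof -
  have "\<bar>M\<bar> * (1 - 2 * \<bar>y\<bar>) = \<bar>M\<bar> - \<bar>y\<bar> * (2 * \<bar>M\<bar>)" by (simp add: algebra_simps)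
  also have "\<dots> \<le> \<bar>M\<bar> - \<bar>y\<bar> * 1" using assms by (intro diff_left_mono mult_left_mono) auto
  also have "\<dots> \<le> \<bar>M - y\<bar>" by linarith
  finally have le: "\<bar>M\<bar> * (1 - 2 * \<bar>y\<bar>) \<le> \<bar>M - y\<bar>" .
  have M: "M \<noteq> 0" "M - y \<noteq> 0" using assms by auto
  then have "1 / (M - y) - 1 / M = y / (M * (M - y))" by (simp add: field_simps)
  then have "\<bar>1 / (M - y) - 1 / M\<bar> = \<bar>y\<bar> / (\<bar>M\<bar> * \<bar>M - y\<bar>)" by (simp add: abs_mult)
  also have "\<dots> \<le> \<bar>y\<bar> / (\<bar>M\<bar> * (\<bar>M\<bar> * (1 - 2 * \<bar>y\<bar>)))"
    using assms M le by (intro divide_left_mono mult_left_mono mult_pos_pos) auto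
  also have "\<dots> = 1 / M\<^sup>2 * (\<bar>y\<bar> / (1 - 2 * \<bar>y\<bar>))"
    by (simp add: power2_eq_square flip: mult.assoc)
  finally show ?thesis .
qed

lemma Q_rem_deriv_bound:
  assumes "\<bar>y\<bar> < 1/2"
  shows "\<bar>Q_rem_deriv k n y\<bar> \<le> s_coeff k n * (\<bar>y\<bar> / (1 - 2 * \<bar>y\<bar>))"
proof -
  let ?P = "1 / (real n + 1/2 + real k - y) - 1 / (real n + 1/2 + real k)"
  let ?M = "1 / (real n + 1/2 - real k - y) - 1 / (real n + 1/2 - real k)"
  have "\<bar>Q_rem_deriv k n y\<bar> \<le> 1 * (\<bar>?P\<bar> + \<bar>?M\<bar>)"
    unfolding Q_rem_deriv_def abs_mult by (intro mult_mono abs_triangle_ineq) auto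
  also have "\<dots> \<le> s_coeff k n * (\<bar>y\<bar> / (1 - 2 * \<bar>y\<bar>))"
    using inverse_shift_bound[OF half_plus_abs_ge(1)[of n k] assms]
      inverse_shift_bound[OF half_plus_abs_ge(2)[of n k] assms]
    unfolding s_coeff_def distrib_right by simp
  finally show ?thesis .
qed

lemma Q_rem_has_derivative:
  assumes "\<rho> < 1/2" "y \<in> {-\<rho>..\<rho>}"
  shows "(Q_rem k n has_field_derivative Q_rem_deriv k n y) (at y within {-\<rho>..\<rho>})"
proof -
  define q where "q y = cos (pi * y) / (real n + 1/2 - y + real k) - 1 / (real n + 1/2 + real k)
     + cos (pi * y) / (real n + 1/2 - y - real k) - 1 / (real n + 1/2 - real k)" for y
  have nz: "real n + 1/2 - y + real k \<noteq> 0" "real n + 1/2 - y - real k \<noteq> 0" if "y \<in> {-\<rho>..\<rho>}" for y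
    using half_plus_abs_ge[of n k] that assms unfolding atLeastAtMost_iff by linarith+
  have "continuous_on {-\<rho>..\<rho>} q"
    unfolding q_def by (intro continuous_intros) (use nz in auto)
  then have "((\<lambda>u. LBINT y=ereal 0..ereal u. q y) has_vector_derivative q y) (at y within {-\<rho>..\<rho>})"
    using assms by (intro interval_integral_FTC2) auto
  moreover have "(\<lambda>u. LBINT y=ereal 0..ereal u. q y) = Q_int k n"
    by (simp add: Q_int_def q_def fun_eq_iff)
  ultimately have "(Q_int k n has_field_derivative q y) (at y within {-\<rho>..\<rho>})"
    by (simp add: has_real_derivative_iff_has_vector_derivative)
  then have "((\<lambda>d. Q_int k n d - a_coeff k n * h_fun d) has_field_derivative
      q y - a_coeff k n * (cos (pi * y) - 1)) (at y within {-\<rho>..\<rho>})"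
    unfolding h_fun_def by (auto intro!: derivative_eq_intros)
  moreover have "q y - a_coeff k n * (cos (pi * y) - 1) = Q_rem_deriv k n y"
    by (simp add: q_def a_coeff_alt Q_rem_deriv_def algebra_simps diff_divide_distrib)
  moreover have "(\<lambda>d. Q_int k n d - a_coeff k n * h_fun d) = Q_rem k n"
    by (simp add: Q_rem_def fun_eq_iff)
  ultimately show ?thesis by simp
qed

lemma Q_int_0: "Q_int k n 0 = 0"
  by (simp add: Q_int_def)

lemma Q_rem_0: "Q_rem k n 0 = 0"
  by (simp add: Q_rem_def Q_int_0 h_fun_def)

lemma Q_rem_Lipschitz:
  assumes \<rho>: "\<rho> < 1/2" and d: "\<bar>d\<bar> \<le> \<rho>" and e: "\<bar>e\<bar> \<le> \<rho>"
  shows "\<bar>Q_rem k n d - Q_rem k n e\<bar> \<le> s_coeff k n * (\<rho> / (1 - 2 * \<rho>)) * \<bar>d - e\<bar>"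
proof -
  have "norm (Q_rem k n d - Q_rem k n e) \<le> s_coeff k n * (\<rho> / (1 - 2 * \<rho>)) * norm (d - e)"
  proof (rule field_differentiable_bound[of "{-\<rho>..\<rho>}"])
    fix y assume y: "y \<in> {-\<rho>..\<rho>}"
    then show "(Q_rem k n has_field_derivative Q_rem_deriv k n y) (at y within {-\<rho>..\<rho>})"
      by (rule Q_rem_has_derivative[OF \<rho>])
    have "\<bar>Q_rem_deriv k n y\<bar> \<le> s_coeff k n * (\<bar>y\<bar> / (1 - 2 * \<bar>y\<bar>))"
      using y \<rho> by (intro Q_rem_deriv_bound) auto
    also have "\<dots> \<le> s_coeff k n * (\<rho> / (1 - 2 * \<rho>))"
      using y \<rho> by (intro mult_left_mono frac_le s_coeff_nonneg) auto
    finally show "norm (Q_rem_deriv k n y) \<le> s_coeff k n * (\<rho> / (1 - 2 * \<rho>))" by simp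
  qed (use d e in auto)
  then show ?thesis by simp
qed


lemma Q_rem_DERIV:
  assumes "\<bar>y\<bar> < 1/2"
  shows "(Q_rem k n has_field_derivative Q_rem_deriv k n y) (at y)"
proof -
  obtain \<rho> where "\<bar>y\<bar> < \<rho>" "\<rho> < 1/2" using dense[OF assms] by blast
  then have "\<rho> < 1/2" "- \<rho> < y" "y < \<rho>" by auto
  then show ?thesis using Q_rem_has_derivative[of \<rho> y k n] by (simp add: at_within_Icc_at)
qed

text \<open>Integrates the bound on the derivative from 0; the denominators 2 and 3 gained this way
  make the self-map estimate succeed.\<close>

lemma cubic_growth:
  fixes f :: "real \<Rightarrow> real"
  assumes der: "\<And>y. \<bar>y\<bar> \<le> \<bar>d\<bar> \<Longrightarrow> (f has_field_derivative f' y) (at y)"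
    and bound: "\<And>y. \<bar>y\<bar> \<le> \<bar>d\<bar> \<Longrightarrow> \<bar>f' y\<bar> \<le> b * \<bar>y\<bar> + c * y\<^sup>2"
    and f0: "f 0 = 0"
  shows "\<bar>f d\<bar> \<le> b * d\<^sup>2 / 2 + c * \<bar>d\<bar> ^ 3 / 3"
proof -
  \<comment> \<open>Stated for a general g so that it applies to f and -f, each at y and at -y,
    which covers both signs of d and of the value.\<close>
  have pos: "g e \<le> b * e\<^sup>2 / 2 + c * e ^ 3 / 3"
    if "0 \<le> e" "e \<le> \<bar>d\<bar>" "g 0 = 0"
      "\<And>y. \<bar>y\<bar> \<le> \<bar>d\<bar> \<Longrightarrow> (g has_field_derivative g' y) (at y)"
      "\<And>y. \<bar>y\<bar> \<le> \<bar>d\<bar> \<Longrightarrow> \<bar>g' y\<bar> \<le> b * \<bar>y\<bar> + c * y\<^sup>2" for g g' :: "real \<Rightarrow> real" and e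
  proof -
    have "b * 0\<^sup>2 / 2 + c * 0 ^ 3 / 3 - g 0 \<le> b * e\<^sup>2 / 2 + c * e ^ 3 / 3 - g e"
    proof (rule DERIV_nonneg_imp_nondecreasing[OF that(1)])
      fix y assume y: "0 \<le> y" "y \<le> e"
      then have "\<bar>y\<bar> \<le> \<bar>d\<bar>" using that by simp
      then have "((\<lambda>y. b * y\<^sup>2 / 2 + c * y ^ 3 / 3 - g y) has_field_derivative b * y + c * y\<^sup>2 - g' y) (at y)"
        by (auto intro!: derivative_eq_intros that(4) simp: power2_eq_square)
      moreover have "0 \<le> b * y + c * y\<^sup>2 - g' y" using that(5)[OF \<open>\<bar>y\<bar> \<le> \<bar>d\<bar>\<close>] y by auto
      ultimately show "\<exists>D. ((\<lambda>y. b * y\<^sup>2 / 2 + c * y ^ 3 / 3 - g y) has_field_derivative D) (at y) \<and> 0 \<le> D"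
        by blast
    qed
    then show ?thesis using that by simp
  qed
  have neg: "((\<lambda>y. f (- y)) has_field_derivative - f' (- y)) (at y)" if "\<bar>y\<bar> \<le> \<bar>d\<bar>" for y
    using der[of "- y"] that by (simp add: DERIV_mirror)
  have "f \<bar>d\<bar> \<le> b * \<bar>d\<bar>\<^sup>2 / 2 + c * \<bar>d\<bar> ^ 3 / 3"
    by (rule pos[where g' = f']) (use assms in auto)
  moreover have "- f \<bar>d\<bar> \<le> b * \<bar>d\<bar>\<^sup>2 / 2 + c * \<bar>d\<bar> ^ 3 / 3"
    by (rule pos[where g = "\<lambda>y. - f y" and g' = "\<lambda>y. - f' y"]) (use assms in \<open>auto intro: DERIV_minus\<close>)
  moreover have "f (- \<bar>d\<bar>) \<le> b * \<bar>d\<bar>\<^sup>2 / 2 + c * \<bar>d\<bar> ^ 3 / 3"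
    by (rule pos[where g = "\<lambda>y. f (- y)" and g' = "\<lambda>y. - f' (- y)"])
       (use f0 neg bound[of "- y" for y] in auto)
  moreover have "- f (- \<bar>d\<bar>) \<le> b * \<bar>d\<bar>\<^sup>2 / 2 + c * \<bar>d\<bar> ^ 3 / 3"
    by (rule pos[where g = "\<lambda>y. - f (- y)" and g' = "\<lambda>y. f' (- y)"])
       (use f0 DERIV_minus[OF neg] bound[of "- y" for y] in auto)
  ultimately show ?thesis by (cases "0 \<le> d") (auto simp: abs_le_iff)
qed

lemma Q_rem_growth:
  assumes \<rho>: "\<rho> < 1/2" and d: "\<bar>d\<bar> \<le> \<rho>"
  shows "\<bar>Q_rem k n d\<bar> \<le> s_coeff k n * (\<rho> / 2 + 2 / (1 - 2 * \<rho>) * \<rho>\<^sup>2 / 3) * \<bar>d\<bar>"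
proof -
  let ?s = "s_coeff k n" and ?a = "2 / (1 - 2 * \<rho>)"
  have "\<bar>Q_rem k n d\<bar> \<le> ?s * d\<^sup>2 / 2 + (?s * ?a) * \<bar>d\<bar> ^ 3 / 3"
  proof (rule cubic_growth)
    fix y assume y: "\<bar>y\<bar> \<le> \<bar>d\<bar>"
    then have lt: "\<bar>y\<bar> < 1/2" using \<rho> d by simp
    then show "(Q_rem k n has_field_derivative Q_rem_deriv k n y) (at y)" by (rule Q_rem_DERIV)
    \<comment> \<open>The linear term stays exact; only the denominator of the quadratic correction
      is frozen at its value for \<rho>.\<close>
    have "\<bar>y\<bar> / (1 - 2 * \<bar>y\<bar>) = \<bar>y\<bar> + 2 / (1 - 2 * \<bar>y\<bar>) * \<bar>y\<bar>\<^sup>2"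
      using lt by (simp add: field_simps power2_eq_square)
    also have "\<dots> \<le> \<bar>y\<bar> + ?a * \<bar>y\<bar>\<^sup>2"
      using y d \<rho> by (intro add_left_mono mult_right_mono frac_le) auto
    finally have "?s * (\<bar>y\<bar> / (1 - 2 * \<bar>y\<bar>)) \<le> ?s * (\<bar>y\<bar> + ?a * y\<^sup>2)"
      by (intro mult_left_mono s_coeff_nonneg) simp
    then show "\<bar>Q_rem_deriv k n y\<bar> \<le> ?s * \<bar>y\<bar> + ?s * ?a * y\<^sup>2"
      using Q_rem_deriv_bound[OF lt, of k n] by (simp add: algebra_simps)
  qed (rule Q_rem_0)
  also have "\<dots> = ?s * (\<bar>d\<bar> / 2 + ?a * \<bar>d\<bar>\<^sup>2 / 3) * \<bar>d\<bar>"
    by (simp add: power2_eq_square power3_eq_cube distrib_left distrib_right)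
  also have "\<dots> \<le> ?s * (\<rho> / 2 + ?a * \<rho>\<^sup>2 / 3) * \<bar>d\<bar>"
    using d \<rho> by (intro mult_right_mono mult_left_mono add_mono divide_right_mono power_mono s_coeff_nonneg) auto
  finally show ?thesis .
qed

lemma h_fun_DERIV: "(h_fun has_field_derivative cos (pi * y) - 1) (at y within A)"
  unfolding h_fun_def by (auto intro!: derivative_eq_intros)

lemma h_fun_deriv_bound: "\<bar>cos (pi * y) - 1\<bar> \<le> pi\<^sup>2 / 2 * y\<^sup>2"
proof -
  have "cos (pi * y) = 1 - 2 * (sin (pi * y / 2))\<^sup>2"
    using cos_double_sin[of "pi * y / 2"] by simp
  moreover have "(sin (pi * y / 2))\<^sup>2 \<le> (pi * y / 2)\<^sup>2"
    by (rule abs_le_square_iff[THEN iffD1, OF abs_sin_x_le_abs_x])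
  ultimately show ?thesis by (simp add: power_mult_distrib power_divide)
qed

lemma h_fun_Lipschitz:
  assumes "\<bar>d\<bar> \<le> \<rho>" "\<bar>e\<bar> \<le> \<rho>"
  shows "\<bar>h_fun d - h_fun e\<bar> \<le> pi\<^sup>2 * \<rho>\<^sup>2 / 2 * \<bar>d - e\<bar>"
proof -
  have "norm (h_fun d - h_fun e) \<le> pi\<^sup>2 * \<rho>\<^sup>2 / 2 * norm (d - e)"
  proof (rule field_differentiable_bound[of "{-\<rho>..\<rho>}", OF _ h_fun_DERIV])
    fix y assume "y \<in> {-\<rho>..\<rho>}"
    then have "y\<^sup>2 \<le> \<rho>\<^sup>2" by (intro abs_le_square_iff[THEN iffD1]) auto
    then have "pi\<^sup>2 / 2 * y\<^sup>2 \<le> pi\<^sup>2 / 2 * \<rho>\<^sup>2" by (intro mult_left_mono) auto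
    from order_trans[OF h_fun_deriv_bound this] show "norm (cos (pi * y) - 1) \<le> pi\<^sup>2 * \<rho>\<^sup>2 / 2"
      by simp
  qed (use assms in auto)
  then show ?thesis by simp
qed

lemma h_fun_growth:
  assumes "\<bar>d\<bar> \<le> \<rho>"
  shows "\<bar>h_fun d\<bar> \<le> pi\<^sup>2 * \<rho>\<^sup>2 / 6 * \<bar>d\<bar>"
proof -
  have "\<bar>h_fun d\<bar> \<le> 0 * d\<^sup>2 / 2 + pi\<^sup>2 / 2 * \<bar>d\<bar> ^ 3 / 3"
    by (rule cubic_growth[OF h_fun_DERIV]) (use h_fun_deriv_bound in \<open>auto simp: h_fun_def\<close>)
  also have "\<dots> = pi\<^sup>2 * \<bar>d\<bar>\<^sup>2 / 6 * \<bar>d\<bar>" by (simp add: power2_eq_square power3_eq_cube)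
  also have "\<dots> \<le> pi\<^sup>2 * \<rho>\<^sup>2 / 6 * \<bar>d\<bar>"
    using assms by (intro mult_right_mono divide_right_mono mult_left_mono power_mono) auto
  finally show ?thesis .
qed

section \<open>Q on sequences\<close>

definition S_matrix :: "nat \<Rightarrow> nat \<Rightarrow> real" where
  "S_matrix k n = (if k = 0 \<or> n = 0 then 0 else s_coeff k n)"

lemma S_matrix_bounded: "bounded_matrix S_matrix (pi\<^sup>2)"
proof (rule schur_test)
  show "0 \<le> S_matrix k n" for k n by (simp add: S_matrix_def s_coeff_nonneg)
  show "(\<Sum>n<N. S_matrix k n) \<le> pi\<^sup>2" for k N
  proof -
    have "(\<Sum>n<N. S_matrix k n) \<le> (\<Sum>n<N. s_coeff k n)"
      by (intro sum_mono) (simp add: S_matrix_def s_coeff_nonneg)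
    also have "\<dots> \<le> (\<Sum>n. s_coeff k n)"
      using sums_squares_row[of k] by (intro sum_le_suminf) (auto simp: s_coeff_def sums_iff)
    also have "\<dots> = pi\<^sup>2" using sums_squares_row[of k] by (simp add: s_coeff_def sums_iff)
    finally show ?thesis .
  qed
  show "(\<Sum>k<K. S_matrix k n) \<le> pi\<^sup>2" for n K
  proof (cases "n = 0")
    case False
    have "(\<lambda>k. S_matrix k n) sums (pi\<^sup>2 - 1 / (real n + 1/2)\<^sup>2)"
      using sums_squares_column[of n] False
      by - (rule sums_from_Suc, simp_all add: S_matrix_def s_coeff_def)
    then have "(\<Sum>k<K. S_matrix k n) \<le> pi\<^sup>2 - 1 / (real n + 1/2)\<^sup>2"
      using sum_le_suminf[of "\<lambda>k. S_matrix k n" "{..<K}"] by (simp add: sums_iff S_matrix_def s_coeff_nonneg)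
    also have "\<dots> \<le> pi\<^sup>2" by simp
    finally show ?thesis .
  qed (simp add: S_matrix_def)
qed simp

text \<open>The series defining \<open>Q_map\<close> may be split only once both parts are known to
  converge: the remainder by comparison with \<open>S_matrix\<close> applied to |x|, the other part
  because h is at most linear, so that h(x) is again square-summable.\<close>

lemma Q_map_sums:
  assumes x: "x \<in> l2" and le: "\<And>n. \<bar>x n\<bar> \<le> \<rho>" and \<rho>: "\<rho> < 1/2" and k: "k \<noteq> 0"
  shows "(\<lambda>m. Q_rem k (Suc m) (x (Suc m))) sums (Q_map x k - mv A_matrix (\<lambda>n. h_fun (x n)) k)"
proof -
  have xs: "sqs x" and x0: "x 0 = 0" using x by (auto simp: l2_def)
  have "0 \<le> \<rho>" using le[of 0] by linarith
  have hx: "sqs (\<lambda>n. h_fun (x n))"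
    by (rule sqs_dominated_scale[OF xs, of _ "pi\<^sup>2 * \<rho>\<^sup>2 / 6"]) (use h_fun_growth[OF le] in auto)
  have ax: "sqs (\<lambda>n. \<bar>x n\<bar>)" using xs by simp
  have "summable (\<lambda>n. S_matrix k n * \<bar>x n\<bar>)"
    using mv_sums[OF S_matrix_bounded ax] by (rule sums_summable)
  then have "summable (\<lambda>m. s_coeff k (Suc m) * \<bar>x (Suc m)\<bar>)"
    using k by (subst (asm) summable_Suc_iff[symmetric]) (simp add: S_matrix_def)
  then have "summable (\<lambda>m. \<rho> / (1 - 2 * \<rho>) * (s_coeff k (Suc m) * \<bar>x (Suc m)\<bar>))"
    by (rule summable_mult)
  then have sR: "summable (\<lambda>m. Q_rem k (Suc m) (x (Suc m)))"
  proof (rule summable_comparison_test'[of _ 0])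
    fix m
    show "norm (Q_rem k (Suc m) (x (Suc m))) \<le> \<rho> / (1 - 2 * \<rho>) * (s_coeff k (Suc m) * \<bar>x (Suc m)\<bar>)"
      using Q_rem_Lipschitz[OF \<rho> le, of 0 "k" "Suc m" "Suc m"] \<open>0 \<le> \<rho>\<close>
      by (simp add: Q_rem_0 mult_ac)
  qed
  have sA: "(\<lambda>m. a_coeff k (Suc m) * h_fun (x (Suc m))) sums mv A_matrix (\<lambda>n. h_fun (x n)) k"
    using sums_drop_zero[OF mv_sums[OF A_matrix_bounded hx, of k]] k by (simp add: A_matrix_def)
  have "(\<lambda>m. Q_int k (Suc m) (x (Suc m))) sums
     ((\<Sum>m. Q_rem k (Suc m) (x (Suc m))) + mv A_matrix (\<lambda>n. h_fun (x n)) k)"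
    using sums_add[OF summable_sums[OF sR] sA] by (simp add: Q_rem_def)
  then have "Q_map x k = (\<Sum>m. Q_rem k (Suc m) (x (Suc m))) + mv A_matrix (\<lambda>n. h_fun (x n)) k"
    using k by (simp add: Q_map_def sums_iff)
  then show ?thesis using summable_sums[OF sR] by simp
qed

text \<open>The constants b and c are left open because the estimate is used twice: with Lipschitz
  constants for two points of the ball, and with the smaller growth constants when y = 0.\<close>

lemma
  assumes x: "x \<in> l2" "\<And>n. \<bar>x n\<bar> \<le> \<rho>" and y: "y \<in> l2" "\<And>n. \<bar>y n\<bar> \<le> \<rho>" and \<rho>: "\<rho> < 1/2"
    and R: "\<And>k n. \<bar>Q_rem k n (x n) - Q_rem k n (y n)\<bar> \<le> s_coeff k n * b * \<bar>x n - y n\<bar>"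
    and h: "\<And>n. \<bar>h_fun (x n) - h_fun (y n)\<bar> \<le> c * \<bar>x n - y n\<bar>"
    and nonneg: "0 \<le> b" "0 \<le> c"
  shows Q_map_diff_sqs: "sqs (\<lambda>k. Q_map x k - Q_map y k)"
    and Q_map_diff_norm: "l2_norm (\<lambda>k. Q_map x k - Q_map y k)
      \<le> (pi\<^sup>2 * b + pi * c) * l2_norm (\<lambda>k. x k - y k)"
proof -
  have xs: "sqs x" and ys: "sqs y" using x y by (auto simp: l2_def)
  define d where "d n = \<bar>x n - y n\<bar>" for n
  have ds: "sqs d" using sqs_diff[OF xs ys] by (simp add: d_def)
  have dn: "l2_norm d = l2_norm (\<lambda>k. x k - y k)" by (simp add: d_def l2_norm_def)
  have hx: "sqs (\<lambda>n. h_fun (x n))"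
    by (rule sqs_dominated_scale[OF xs, of _ "pi\<^sup>2 * \<rho>\<^sup>2 / 6"]) (use h_fun_growth[OF x(2)] in auto)
  have hy: "sqs (\<lambda>n. h_fun (y n))"
    by (rule sqs_dominated_scale[OF ys, of _ "pi\<^sup>2 * \<rho>\<^sup>2 / 6"]) (use h_fun_growth[OF y(2)] in auto)
  define H where "H n = h_fun (x n) - h_fun (y n)" for n
  have H: "sqs H" and Hn: "l2_norm H \<le> c * l2_norm d"
    unfolding H_def
    by (rule sqs_dominated_scale[OF ds _ nonneg(2)] l2_norm_dominated_scale[OF ds _ nonneg(2)];
        use h in \<open>simp add: d_def\<close>)+
  let ?SS = "\<lambda>k. b * mv S_matrix d k"
  have SS: "sqs (mv S_matrix d)" by (rule sqs_mv[OF S_matrix_bounded ds])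
  \<comment> \<open>The remainder is dominated term by term, whereas the A part keeps its signs as A
    applied to H; absolute values are taken there only after summation.\<close>
  have le: "\<bar>Q_map x k - Q_map y k\<bar> \<le> \<bar>mv A_matrix H k\<bar> + \<bar>?SS k\<bar>" for k
  proof (cases "k = 0")
    case True
    then show ?thesis by (simp add: Q_map_def)
  next
    case k: False
    have "(\<lambda>m. s_coeff k (Suc m) * d (Suc m)) sums mv S_matrix d k"
      using sums_drop_zero[OF mv_sums[OF S_matrix_bounded ds, of k]] k by (simp add: S_matrix_def)
    then have sS: "(\<lambda>m. b * (s_coeff k (Suc m) * d (Suc m))) sums ?SS k" by (rule sums_mult)
    have D: "(\<lambda>m. Q_rem k (Suc m) (x (Suc m)) - Q_rem k (Suc m) (y (Suc m))) sums
      (Q_map x k - mv A_matrix (\<lambda>n. h_fun (x n)) k - (Q_map y k - mv A_matrix (\<lambda>n. h_fun (y n)) k))"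
      by (intro sums_diff Q_map_sums[OF _ _ \<rho> k] x y)
    have D_le: "\<bar>Q_rem k (Suc m) (x (Suc m)) - Q_rem k (Suc m) (y (Suc m))\<bar> \<le> b * (s_coeff k (Suc m) * d (Suc m))" for m
      using R[of k "Suc m"] by (simp add: d_def mult_ac)
    have "\<bar>\<Sum>m. Q_rem k (Suc m) (x (Suc m)) - Q_rem k (Suc m) (y (Suc m))\<bar> \<le> (\<Sum>m. b * (s_coeff k (Suc m) * d (Suc m)))"
      using norm_suminf_le[of "\<lambda>m. Q_rem k (Suc m) (x (Suc m)) - Q_rem k (Suc m) (y (Suc m))"
          "\<lambda>m. b * (s_coeff k (Suc m) * d (Suc m))"] D_le sums_summable[OF sS] by simp
    then have "\<bar>Q_map x k - mv A_matrix (\<lambda>n. h_fun (x n)) k - (Q_map y k - mv A_matrix (\<lambda>n. h_fun (y n)) k)\<bar> \<le> ?SS k"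
      using D sS by (simp add: sums_iff)
    moreover have "mv A_matrix H k = mv A_matrix (\<lambda>n. h_fun (x n)) k - mv A_matrix (\<lambda>n. h_fun (y n)) k"
      unfolding H_def by (rule mv_diff[OF A_matrix_bounded hx hy])
    ultimately show ?thesis by linarith
  qed
  show "sqs (\<lambda>k. Q_map x k - Q_map y k)"
    by (rule sqs_dominated[OF sqs_mv[OF A_matrix_bounded H] sqs_cmult[OF SS] le])
  have "l2_norm (\<lambda>k. Q_map x k - Q_map y k) \<le> l2_norm (mv A_matrix H) + l2_norm ?SS"
    by (rule l2_norm_dominated[OF sqs_mv[OF A_matrix_bounded H] sqs_cmult[OF SS] le])
  also have "\<dots> \<le> pi * (c * l2_norm d) + b * (pi\<^sup>2 * l2_norm d)"
  proof (intro add_mono)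
    have "l2_norm (mv A_matrix H) \<le> pi * l2_norm H" by (rule l2_norm_mv[OF A_matrix_bounded H])
    also have "\<dots> \<le> pi * (c * l2_norm d)" by (intro mult_left_mono Hn) simp
    finally show "l2_norm (mv A_matrix H) \<le> pi * (c * l2_norm d)" .
    have "l2_norm ?SS \<le> b * l2_norm (mv S_matrix d)"
      by (rule l2_norm_dominated_scale[OF SS]) (simp_all add: abs_mult nonneg)
    also have "\<dots> \<le> b * (pi\<^sup>2 * l2_norm d)"
      by (intro mult_left_mono l2_norm_mv[OF S_matrix_bounded ds] nonneg)
    finally show "l2_norm ?SS \<le> b * (pi\<^sup>2 * l2_norm d)" .
  qed
  also have "\<dots> = (pi\<^sup>2 * b + pi * c) * l2_norm (\<lambda>k. x k - y k)"
    by (simp add: dn algebra_simps)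
  finally show "l2_norm (\<lambda>k. Q_map x k - Q_map y k) \<le> (pi\<^sup>2 * b + pi * c) * l2_norm (\<lambda>k. x k - y k)" .
qed

section \<open>The norm of w\<close>

text \<open>
  The coefficient \<open>68/9\<close> makes \<open>(1 + t) / (1 - t)\<^sup>2 \<le> 1 + 3 * t + 68/9 * t\<^sup>2\<close> an
  equality at \<open>t = 1/4\<close>, the largest value of \<open>t = x\<^sup>2 / k\<^sup>2\<close>.
\<close>

lemma symmetrised_kernel_bound:
  fixes x k :: real
  assumes x: "\<bar>x\<bar> \<le> 1/2" and k: "1 \<le> k"
  shows "1 / (x - k)\<^sup>2 + 1 / (- x - k)\<^sup>2 \<le> 2 / k\<^sup>2 * (1 + 3 * x\<^sup>2 + 68/9 * x ^ 4)"
proof -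
  define t where "t = x\<^sup>2 / k\<^sup>2"
  have k2: "1 \<le> k\<^sup>2" using k by (simp add: one_le_power)
  have x2: "x\<^sup>2 \<le> 1/4" using power_mono[OF x, of 2] by (simp add: power2_eq_square)
  have "t \<le> x\<^sup>2 / 1" unfolding t_def using k2 by (intro divide_left_mono) auto
  then have t: "t \<le> x\<^sup>2" "t \<le> 1/4" using x2 by linarith+
  have t0: "0 \<le> t" by (simp add: t_def)
  have nz: "x - k \<noteq> 0" "- x - k \<noteq> 0" "k \<noteq> 0" using x k by auto
  have "1 / (x - k)\<^sup>2 + 1 / (- x - k)\<^sup>2 = 2 / k\<^sup>2 * ((1 + t) / (1 - t)\<^sup>2)"
  proof -
    have e: "(x - k)\<^sup>2 * (- x - k)\<^sup>2 = (k\<^sup>2 * (1 - t))\<^sup>2"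
      using nz by (simp add: t_def right_diff_distrib flip: power_mult_distrib) (simp add: algebra_simps power2_eq_square)
    have f: "(x - k)\<^sup>2 + (- x - k)\<^sup>2 = 2 * k\<^sup>2 * (1 + t)"
      using nz by (simp add: t_def distrib_left) (simp add: algebra_simps power2_eq_square)
    have "1 / (x - k)\<^sup>2 + 1 / (- x - k)\<^sup>2 = ((x - k)\<^sup>2 + (- x - k)\<^sup>2) / ((x - k)\<^sup>2 * (- x - k)\<^sup>2)"
      using nz by (simp add: add_divide_distrib)
    also have "\<dots> = 2 / k\<^sup>2 * ((1 + t) / (1 - t)\<^sup>2)"
      unfolding e f using nz t by (simp add: power_mult_distrib power2_eq_square)
    finally show ?thesis .
  qed
  also have "(1 + t) / (1 - t)\<^sup>2 \<le> 1 + 3 * t + 68/9 * t\<^sup>2"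
  proof -
    have "(1 + 3 * t + 68/9 * t\<^sup>2) * (1 - t)\<^sup>2 - (1 + t) = t\<^sup>2 * (1 - 4 * t) * (23 - 17 * t) / 9"
      by (simp add: power2_eq_square field_simps)
    also have "\<dots> \<ge> 0" using t t0 by simp
    finally show ?thesis using t by (simp add: pos_divide_le_eq)
  qed
  \<comment> \<open>Replacing t by x^2, with equality at k = 1, confines the dependence on k to the
    factor 2 / k^2, so one integral serves all k.\<close>
  also have "1 + 3 * t + 68/9 * t\<^sup>2 \<le> 1 + 3 * x\<^sup>2 + 68/9 * (x\<^sup>2)\<^sup>2"
    using t t0 by (intro add_mono mult_left_mono power_mono) auto
  also have "(x\<^sup>2)\<^sup>2 = x ^ 4" by simp
  finally show ?thesis using nz by (simp add: mult_left_mono divide_right_mono)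
qed

lemma has_integral_cos_quartic:
  "((\<lambda>x. cos (pi * x) * (1 + 3 * x\<^sup>2 + 68/9 * x ^ 4)) has_integral
     (40/9 / pi - 172/3 / pi ^ 3 + 1088/3 / pi ^ 5)) {-1/2..1/2::real}"
proof -
  \<comment> \<open>Repeated integration by parts: for the quartic p, F = sin(pi x) (p/pi - p''/pi^3
    + p''''/pi^5) + cos(pi x) (p'/pi^2 - p'''/pi^4). At the end points the cosine part
    vanishes.\<close>
  define F where "F x = sin (pi * x) * ((1 + 3 * x\<^sup>2 + 68/9 * x ^ 4) / pi - (6 + 272/3 * x\<^sup>2) / pi ^ 3 + 544/3 / pi ^ 5)
      + cos (pi * x) * ((6 * x + 272/9 * x ^ 3) / pi\<^sup>2 - 544/3 * x / pi ^ 4)" for x :: real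
  have "(F has_real_derivative cos (pi * x) * (1 + 3 * x\<^sup>2 + 68/9 * x ^ 4)) (at x within {-1/2..1/2})" for x
    unfolding F_def
    by (rule derivative_eq_intros refl | simp)+
       (simp add: field_simps power2_eq_square power3_eq_cube eval_nat_numeral)
  then have "((\<lambda>x. cos (pi * x) * (1 + 3 * x\<^sup>2 + 68/9 * x ^ 4)) has_integral F (1/2) - F (- 1/2)) {-1/2..1/2}"
    by (intro fundamental_theorem_of_calculus) (auto simp: has_real_derivative_iff_has_vector_derivative)
  moreover have "F (1/2) - F (- 1/2) = 40/9 / pi - 172/3 / pi ^ 3 + 1088/3 / pi ^ 5"
    by (simp add: F_def power2_eq_square eval_nat_numeral)
  ultimately show ?thesis by simp
qed

lemma pi_square_bounds: "9.8696 \<le> pi\<^sup>2" "pi\<^sup>2 \<le> 9.86961"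
  using mult_mono[OF pi_approx(1) pi_approx(1)] mult_mono[OF pi_approx(2) pi_approx(2)]
  by (simp_all add: power2_eq_square)

text \<open>Multiplied by pi^5 the claim involves only powers of pi^2. The integral divided by pi is
  about 0.2390, rounded up to 0.2392.\<close>

lemma cos_quartic_integral_bound: "40/9 / pi - 172/3 / pi ^ 3 + 1088/3 / pi ^ 5 \<le> 0.2392 * pi"
proof -
  have p: "9.8696 \<le> pi\<^sup>2" "pi\<^sup>2 \<le> 9.86961" by (rule pi_square_bounds)+
  have "9.8696 ^ 3 \<le> (pi\<^sup>2) ^ 3" "(pi\<^sup>2)\<^sup>2 \<le> 9.86961\<^sup>2"
    using p by (intro power_mono; simp)+
  then have "40/9 * (pi\<^sup>2)\<^sup>2 - 172/3 * pi\<^sup>2 + 1088/3 \<le> 0.2392 * (pi\<^sup>2) ^ 3"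
    using p by (simp add: power2_eq_square power3_eq_cube)
  then have "(40/9 * (pi\<^sup>2)\<^sup>2 - 172/3 * pi\<^sup>2 + 1088/3) / pi ^ 5 \<le> 0.2392 * (pi\<^sup>2) ^ 3 / pi ^ 5"
    by (intro divide_right_mono) auto
  also have "0.2392 * (pi\<^sup>2) ^ 3 / pi ^ 5 = 0.2392 * pi" by (simp add: eval_nat_numeral)
  also have "(40/9 * (pi\<^sup>2)\<^sup>2 - 172/3 * pi\<^sup>2 + 1088/3) / pi ^ 5 = 40/9 / pi - 172/3 / pi ^ 3 + 1088/3 / pi ^ 5"
    by (simp add: add_divide_distrib diff_divide_distrib) (simp add: eval_nat_numeral)
  finally show ?thesis .
qed

lemma w_seq_bounds:
  assumes "k \<noteq> 0"
  shows "0 \<le> w_seq k" "w_seq k \<le> 0.2392 / (real k)\<^sup>2"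
proof -
  let ?I = "{-1/2..1/2::real}"
  define f where "f x = cos (pi * x) / (x - real k)\<^sup>2" for x
  have k: "1 \<le> real k" using assms by simp
  have cos: "0 \<le> cos (pi * x)" if "x \<in> ?I" for x
  proof (rule cos_ge_zero)
    have "pi * (- 1/2) \<le> pi * x" "pi * x \<le> pi * (1/2)" using that by (intro mult_left_mono; simp)+
    then show "- (pi / 2) \<le> pi * x" "pi * x \<le> pi / 2" by simp_all
  qed
  have "continuous_on ?I f"
    unfolding f_def by (intro continuous_intros) (use k in auto)
  then have int: "set_integrable lborel ?I f" by (rule borel_integrable_atLeastAtMost')
  have w: "w_seq k = 1 / pi * integral ?I f"
    using assms set_borel_integral_eq_integral(2)[OF int] by (simp add: w_seq_def f_def)
  have fi: "f integrable_on ?I" by (rule set_borel_integral_eq_integral(1)[OF int])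
  have "0 \<le> integral ?I f"
    by (rule Henstock_Kurzweil_Integration.integral_nonneg[OF fi]) (simp add: f_def cos)
  then show "0 \<le> w_seq k" unfolding w by simp
  \<comment> \<open>The interval is symmetric, so f and its reflection have the same integral, and
    in their sum the contribution odd in x cancels.\<close>
  have refl: "((\<lambda>x. f (- x)) has_integral integral ?I f) ?I"
    using has_integral_reflect_real[of f "integral ?I f" "1/2" "-1/2"] integrable_integral[OF fi] by simp
  have "((\<lambda>x. f x + f (- x)) has_integral integral ?I f + integral ?I f) ?I"
    by (rule has_integral_add[OF integrable_integral[OF fi] refl])
  moreover have "((\<lambda>x. 2 / (real k)\<^sup>2 * (cos (pi * x) * (1 + 3 * x\<^sup>2 + 68/9 * x ^ 4))) has_integral
      2 / (real k)\<^sup>2 * (40/9 / pi - 172/3 / pi ^ 3 + 1088/3 / pi ^ 5)) ?I"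
    by (rule has_integral_mult_right[OF has_integral_cos_quartic])
  moreover have "f x + f (- x) \<le> 2 / (real k)\<^sup>2 * (cos (pi * x) * (1 + 3 * x\<^sup>2 + 68/9 * x ^ 4))" if "x \<in> ?I" for x
  proof -
    have "\<bar>x\<bar> \<le> 1/2" using that by auto
    from mult_left_mono[OF symmetrised_kernel_bound[OF this k] cos[OF that]]
    show ?thesis by (simp add: f_def distrib_left mult.left_commute)
  qed
  ultimately have "integral ?I f + integral ?I f \<le> 2 / (real k)\<^sup>2 * (40/9 / pi - 172/3 / pi ^ 3 + 1088/3 / pi ^ 5)"
    by (rule has_integral_le)
  also have "\<dots> \<le> 2 / (real k)\<^sup>2 * (0.2392 * pi)"
    by (intro mult_left_mono cos_quartic_integral_bound) auto
  finally have "1 / pi * integral ?I f \<le> 1 / pi * (1 / (real k)\<^sup>2 * (0.2392 * pi))"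
    by (intro mult_left_mono) auto
  then show "w_seq k \<le> 0.2392 / (real k)\<^sup>2" unfolding w by simp
qed

text \<open>
  The tail is compared with a telescoping series, since \<open>1 / m\<^sup>4\<close> is at most
  \<open>(1 / (m - 1/2)\<^sup>3 - 1 / (m + 1/2)\<^sup>3) / 3\<close>.
\<close>

lemma sum_inverse_fourth_powers: "(\<Sum>j<J. 1 / real (Suc j) ^ 4) \<le> 89/81"
proof -
  \<comment> \<open>Carrying the telescoped tail makes the induction close. At J = 0 it equals 8/81,
    whence 89/81 = 1 + 8/81.\<close>
  have "(\<Sum>j<Suc J. 1 / real (Suc j) ^ 4) \<le> 89/81 - 1/3 / (real J + 3/2) ^ 3" for J
  proof (induction J)
    case 0
    show ?case by (simp add: power3_eq_cube)
  next
    case (Suc J)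
    define m where "m = real J + 2"
    have m: "2 \<le> m" by (simp add: m_def)
    have "1 / m ^ 4 = m\<^sup>2 / (m\<^sup>2) ^ 3" using m by (simp add: eval_nat_numeral)
    \<comment> \<open>Both changes enlarge the fraction and make it exactly the telescoping
      difference: ((m + 1/2)^3 - (m - 1/2)^3) / 3 = m^2 + 1/12.\<close>
    also have "\<dots> \<le> (m\<^sup>2 + 1/12) / (m\<^sup>2 - 1/4) ^ 3"
    proof (intro frac_le power_mono)
      have "4 \<le> m\<^sup>2" using power_mono[OF m, of 2] by simp
      then show "0 \<le> m\<^sup>2 - 1/4" "0 < (m\<^sup>2 - 1/4) ^ 3" by simp_all
    qed auto
    also have "\<dots> = 1/3 / (m - 1/2) ^ 3 - 1/3 / (m + 1/2) ^ 3"
    proof -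
      have "m - 1/2 \<noteq> 0" "m + 1/2 \<noteq> 0" using m by auto
      then have "1/3 / (m - 1/2) ^ 3 - 1/3 / (m + 1/2) ^ 3
        = (((m + 1/2) ^ 3 - (m - 1/2) ^ 3) / 3) / ((m - 1/2) ^ 3 * (m + 1/2) ^ 3)"
        by (simp add: diff_divide_distrib)
      also have "((m + 1/2) ^ 3 - (m - 1/2) ^ 3) / 3 = m\<^sup>2 + 1/12"
        by (simp add: power2_eq_square power3_eq_cube algebra_simps)
      also have "(m - 1/2) ^ 3 * (m + 1/2) ^ 3 = (m\<^sup>2 - 1/4) ^ 3"
        by (simp add: power2_eq_square algebra_simps flip: power_mult_distrib)
      finally show ?thesis by simp
    qed
    finally have "1 / (real J + 2) ^ 4 \<le> 1/3 / (real J + 3/2) ^ 3 - 1/3 / (real J + 5/2) ^ 3"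
      by (simp add: m_def algebra_simps)
    then show ?case using Suc.IH by (simp add: add.commute)
  qed
  moreover have "(\<Sum>j<J. 1 / real (Suc j) ^ 4) \<le> (\<Sum>j<Suc J. 1 / real (Suc j) ^ 4)" by simp
  moreover have "0 \<le> 1/3 / (real J + 3/2) ^ 3" by simp
  ultimately show ?thesis by (smt (verit))
qed

text \<open>The factor sqrt 8 is the one that \<open>B_op_norm_le\<close> divides out; 0.2392 *
  sqrt(89/81) / sqrt 8 is about 0.0886.\<close>

lemma w_seq_l2: "w_seq \<in> l2" and w_seq_norm: "l2_norm w_seq \<le> 0.0888 * sqrt 8"
proof -
  have "(\<Sum>k<K. (w_seq k)\<^sup>2) \<le> (0.0888 * sqrt 8)\<^sup>2" for K
  proof -
    have "(\<Sum>k<K. (w_seq k)\<^sup>2) \<le> (\<Sum>k<Suc K. (w_seq k)\<^sup>2)" by simp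
    also have "\<dots> = (\<Sum>j<K. (w_seq (Suc j))\<^sup>2)"
      by (subst sum.lessThan_Suc_shift) (simp add: w_seq_def)
    also have "\<dots> \<le> (\<Sum>j<K. 0.2392\<^sup>2 * (1 / real (Suc j) ^ 4))"
    proof (rule sum_mono)
      fix j
      have "(w_seq (Suc j))\<^sup>2 \<le> (0.2392 / (real (Suc j))\<^sup>2)\<^sup>2"
        by (intro power_mono w_seq_bounds) simp_all
      then show "(w_seq (Suc j))\<^sup>2 \<le> 0.2392\<^sup>2 * (1 / real (Suc j) ^ 4)"
        by (simp add: power_divide flip: power_mult)
    qed
    also have "\<dots> \<le> 0.2392\<^sup>2 * (89/81)"
      unfolding sum_distrib_left[symmetric] by (intro mult_left_mono sum_inverse_fourth_powers) simp
    also have "\<dots> \<le> (0.0888 * sqrt 8)\<^sup>2" by (simp add: power_mult_distrib power2_eq_square)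
    finally show ?thesis .
  qed
  moreover have "w_seq 0 = 0" by (simp add: w_seq_def)
  ultimately show "w_seq \<in> l2" "l2_norm w_seq \<le> 0.0888 * sqrt 8"
    using sqs_bound[of w_seq "0.0888 * sqrt 8"] by (simp_all add: l2_def)
qed

section \<open>Numerical estimates on the ball and the contraction\<close>

definition shift_arg :: "(nat \<Rightarrow> real) \<Rightarrow> nat \<Rightarrow> real" where
  "shift_arg x = (\<lambda>k. x k + B_op w_seq k)"

lemma B_op_w_norm: "l2_norm (B_op w_seq) \<le> 0.0888"
  by (rule B_op_norm_le[OF w_seq_l2 w_seq_norm])

lemma
  assumes "x \<in> K_ball"
  shows shift_arg_l2: "shift_arg x \<in> l2" and shift_arg_norm: "l2_norm (shift_arg x) \<le> 0.1308"
    and shift_arg_le: "\<bar>shift_arg x n\<bar> \<le> 0.1308"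
proof -
  have x: "x \<in> l2" "l2_norm x \<le> 0.042" using assms by (auto simp: K_ball_def)
  show l: "shift_arg x \<in> l2"
    unfolding shift_arg_def by (rule l2_add[OF x(1) B_op_l2[OF w_seq_l2]])
  have "l2_norm (shift_arg x) \<le> l2_norm x + l2_norm (B_op w_seq)"
    unfolding shift_arg_def using x(1) B_op_l2[OF w_seq_l2] by (intro l2_norm_add) (auto simp: l2_def)
  then show n: "l2_norm (shift_arg x) \<le> 0.1308" using x(2) B_op_w_norm by simp
  show "\<bar>shift_arg x n\<bar> \<le> 0.1308"
    using abs_le_l2_norm[of "shift_arg x" n] l n by (simp add: l2_def)
qed

lemma Q_map_zero: "Q_map (\<lambda>_. 0) = (\<lambda>_. 0)"
  by (simp add: Q_map_def Q_int_0 fun_eq_iff)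

lemma zero_l2: "(\<lambda>_. 0) \<in> l2"
  by (simp add: l2_def)

text \<open>Comparison with Q 0 = 0, using the growth constants; they multiply the norm of the
  shifted argument, at most 0.1308, and not that of x.\<close>

lemma
  assumes "x \<in> K_ball"
  shows Q_map_shift_l2: "Q_map (shift_arg x) \<in> l2"
    and Q_map_shift_norm: "l2_norm (Q_map (shift_arg x)) \<le> 0.042 * sqrt 8"
proof -
  let ?\<rho> = "0.1308 :: real"
  let ?b = "?\<rho> / 2 + 2 / (1 - 2 * ?\<rho>) * ?\<rho>\<^sup>2 / 3" and ?c = "pi\<^sup>2 * ?\<rho>\<^sup>2 / 6"
  note le = shift_arg_le[OF assms]
  have R: "\<bar>Q_rem k n (shift_arg x n) - Q_rem k n 0\<bar> \<le> s_coeff k n * ?b * \<bar>shift_arg x n - 0\<bar>" for k n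
    using Q_rem_growth[OF _ le, of k n n] by (simp add: Q_rem_0)
  have h: "\<bar>h_fun (shift_arg x n) - h_fun 0\<bar> \<le> ?c * \<bar>shift_arg x n - 0\<bar>" for n
    using h_fun_growth[OF le, of n] by (simp add: h_fun_def[of 0])
  have nonneg: "0 \<le> ?b" "0 \<le> ?c" by simp_all
  have "?\<rho> < 1/2" "\<bar>0\<bar> \<le> ?\<rho>" by simp_all
  note diff = shift_arg_l2[OF assms] le zero_l2 \<open>\<bar>0\<bar> \<le> ?\<rho>\<close> \<open>?\<rho> < 1/2\<close> R h nonneg
  have "sqs (Q_map (shift_arg x))"
    using Q_map_diff_sqs[OF diff] by (simp add: Q_map_zero)
  then show "Q_map (shift_arg x) \<in> l2" by (simp add: l2_def Q_map_def)
  have "l2_norm (Q_map (shift_arg x)) \<le> (pi\<^sup>2 * ?b + pi * ?c) * l2_norm (shift_arg x)"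
    using Q_map_diff_norm[OF diff] by (simp add: Q_map_zero)
  also have "\<dots> \<le> (9.86961 * ?b + 3.1416 * (9.86961 * ?\<rho>\<^sup>2 / 6)) * ?\<rho>"
    using pi_square_bounds pi_approx shift_arg_norm[OF assms]
    by (intro mult_mono add_mono divide_right_mono l2_norm_nonneg) (use shift_arg_l2[OF assms] in \<open>auto simp: l2_def\<close>)
  \<comment> \<open>About 0.1159 against 0.1188; 2.8284 is sqrt 8 rounded down.\<close>
  also have "\<dots> \<le> 0.042 * 2.8284" by (simp add: power2_eq_square)
  also have "\<dots> \<le> 0.042 * sqrt 8"
    by (intro mult_left_mono real_le_rsqrt) (simp_all add: power2_eq_square)
  finally show "l2_norm (Q_map (shift_arg x)) \<le> 0.042 * sqrt 8" .
qed

lemma Q_map_shift_diff: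
  assumes "x \<in> K_ball" "y \<in> K_ball"
  shows "l2_norm (\<lambda>k. Q_map (shift_arg x) k - Q_map (shift_arg y) k)
    \<le> 0.73 * sqrt 8 * l2_norm (\<lambda>k. x k - y k)"
proof -
  let ?\<rho> = "0.1308 :: real"
  let ?b = "?\<rho> / (1 - 2 * ?\<rho>)" and ?c = "pi\<^sup>2 * ?\<rho>\<^sup>2 / 2"
  note le = shift_arg_le[OF assms(1)] shift_arg_le[OF assms(2)]
  have \<rho>: "?\<rho> < 1/2" by simp
  have "sqs x" "sqs y" using assms by (auto simp: K_ball_def l2_def)
  then have nn: "0 \<le> l2_norm (\<lambda>k. x k - y k)" by (intro l2_norm_nonneg sqs_diff)
  have "l2_norm (\<lambda>k. Q_map (shift_arg x) k - Q_map (shift_arg y) k)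
      \<le> (pi\<^sup>2 * ?b + pi * ?c) * l2_norm (\<lambda>k. shift_arg x k - shift_arg y k)"
    using shift_arg_l2[OF assms(1)] le(1) shift_arg_l2[OF assms(2)] le(2) \<rho>
      Q_rem_Lipschitz[OF \<rho> le] h_fun_Lipschitz[OF le]
    by (rule Q_map_diff_norm) simp_all
  \<comment> \<open>The translation by B w cancels, so the contraction involves w only through the
    radius 0.1308.\<close>
  also have "(\<lambda>k. shift_arg x k - shift_arg y k) = (\<lambda>k. x k - y k)"
    by (simp add: shift_arg_def)
  also have "(pi\<^sup>2 * ?b + pi * ?c) * l2_norm (\<lambda>k. x k - y k) \<le> (0.73 * sqrt 8) * l2_norm (\<lambda>k. x k - y k)"
  proof (rule mult_right_mono[OF _ nn])
    have "pi\<^sup>2 * ?b + pi * ?c \<le> 9.86961 * ?b + 3.1416 * (9.86961 * ?\<rho>\<^sup>2 / 2)"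
      using pi_square_bounds pi_approx
      by (intro mult_mono add_mono divide_right_mono) auto
    \<comment> \<open>About 2.014 against 2.065.\<close>
    also have "\<dots> \<le> 0.73 * 2.8284" by (simp add: power2_eq_square)
    also have "\<dots> \<le> 0.73 * sqrt 8"
      by (intro mult_left_mono real_le_rsqrt) (simp_all add: power2_eq_square)
    finally show "pi\<^sup>2 * ?b + pi * ?c \<le> 0.73 * sqrt 8" .
  qed
  finally show ?thesis .
qed

lemma G_map_eq: "G_map x = (\<lambda>n. - B_op (Q_map (shift_arg x)) n)"
  by (simp add: G_map_def shift_arg_def)

lemma l2_norm_uminus: "l2_norm (\<lambda>k. - x k) = l2_norm x"
  by (simp add: l2_norm_def)

theorem theorem3:
  shows "G_map ` K_ball \<subseteq> K_ball \<and>
    (\<forall>x\<in>K_ball. \<forall>y\<in>K_ball.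
      l2_norm (\<lambda>k. G_map x k - G_map y k) \<le> 0.73 * l2_norm (\<lambda>k. x k - y k))"
proof (intro conjI ballI image_subsetI)
  fix x assume x: "x \<in> K_ball"
  have "l2_norm (B_op (Q_map (shift_arg x))) \<le> 0.042"
    by (rule B_op_norm_le[OF Q_map_shift_l2[OF x] Q_map_shift_norm[OF x]])
  then show "G_map x \<in> K_ball"
    using B_op_l2[OF Q_map_shift_l2[OF x]] l2_norm_uminus
    by (simp add: G_map_eq K_ball_def l2_def)
next
  fix x y assume xy: "x \<in> K_ball" "y \<in> K_ball"
  let ?D = "\<lambda>k. Q_map (shift_arg x) k - Q_map (shift_arg y) k"
  have "l2_norm (\<lambda>k. G_map x k - G_map y k) = l2_norm (\<lambda>k. - (G_map x k - G_map y k))"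
    by (rule l2_norm_uminus[symmetric])
  also have "\<dots> = l2_norm (B_op ?D)"
    by (simp add: G_map_eq B_op_diff Q_map_shift_l2 xy)
  also have "\<dots> \<le> 0.73 * l2_norm (\<lambda>k. x k - y k)"
    using Q_map_shift_diff[OF xy] by (intro B_op_norm_le l2_diff Q_map_shift_l2 xy) (simp add: mult_ac)
  finally show "l2_norm (\<lambda>k. G_map x k - G_map y k) \<le> 0.73 * l2_norm (\<lambda>k. x k - y k)" .
qed

end
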